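(* Let $n\ge 3$ and $r\ge 1$ be integers, and let $G$ be a finite simple connected graph with $N_0$ vertices and $E_0\ge 1$ edges. Let $CL_r(G)$ be the $r$-th clique-blew up iterative graph of $G$. Then the Kemeny's constant of the random walk on $CL_r(G)$ is $$\begin{aligned} K_e(CL_r(G))=&(n-1)^rK_e(G)+\frac{(n-1)^{r+1}}{2n}\left(\frac{1}{(n-1)^r}-1\right)N_0\\ &+\left(\frac{3(n-1)^r}{n}\left(\frac{n^r}{2^r}-1\right)+\frac{(n-1)^r}{n+1}\left(1-\frac{n^{r-1}}{2^{r-1}}\right)+\frac{(n-1)^{r}}{n(n+1)}\left(1-\frac{1}{(n-1)^{r-1}}\right)\right)E_0. \end{aligned}$$
   Context: Clique-blew up graph: fix an integer $n\ge 3$. For a graph $G$, the graph $CL(G)$ is obtained from $G$ by adding, for every edge $e$ of $G$, $n-2$ new vertices (distinct edges receive disjoint sets of new vertices) and the edges needed so that these new vertices together with the two end-vertices of $e$ form a complete graph $K_n$. Iterates: $CL_0(G)=G$ and $CL_r(G)=CL(CL_{r-1}(G))$ for $r\ge1$ (with the same $n$ at every step). Kemeny's constant: for a connected graph $H$ with at least one edge, consider the random walk on $H$ that moves from a vertex $i$ to each neighbour with probability $1/d_i$, where $d_i$ is the degree of $i$. $K_e(H)$ is the expected number of steps to go from an initial vertex $i$ to a target vertex $j$ chosen at random according to the stationary distribution of the walk (with $0$ steps needed if $j=i$); it does not depend on $i$. Equivalently, if $0=\lambda_1<\lambda_2\le\cdots\le\lambda_N$ are the eigenvalues of the normalized Laplacian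 of $H$ (the matrix with entries $\delta_{ij}-A_H(i,j)/\sqrt{d_id_j}$, where $A_H$ is the adjacency matrix), then $K_e(H)=\sum_{i=2}^{N}\frac{1}{\lambda_i}$. *)

theory Defs
  imports "HOL-Probability.Probability" "HOL-Library.Uprod"
begin

record 'v ugraph =
  verts :: "'v set"
  edges :: "'v uprod set"

definition finite_simple_graph :: "'v ugraph \<Rightarrow> bool" where
  "finite_simple_graph G \<longleftrightarrow>
     finite (verts G) \<and> (\<forall>e\<in>edges G. proper_uprod e \<and> set_uprod e \<subseteq> verts G)"

definition connected_graph :: "'v ugraph \<Rightarrow> bool" where
  "connected_graph G \<longleftrightarrow>
     verts G \<noteq> {} \<and>
     (\<forall>u\<in>verts G. \<forall>v\<in>verts G. (u, v) \<in> {(x, y). Upair x y \<in> edges G}\<^sup>*)"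

definition neighbours :: "'v ugraph \<Rightarrow> 'v \<Rightarrow> 'v set" where
  "neighbours G v = {w. Upair v w \<in> edges G}"

(* The iterates of a graph on 'a all live on one type. Base v is a vertex of the initial graph.
   One blow-up step renames every present vertex v to Old v, so that the vertices New e i added
   for an edge e are fresh; this matters because e stays an edge in all later iterates and gets
   new vertices again at each step. *)
datatype 'a cl_vertex =
    Base 'a
  | Old "'a cl_vertex"
  | New "'a cl_vertex uprod" nat

definition cl_clique :: "nat \<Rightarrow> 'a cl_vertex uprod \<Rightarrow> 'a cl_vertex set" where
  "cl_clique n e = Old ` set_uprod e \<union> New e ` {..<n - 2}"

(* The edges of G survive: Old x and Old y lie in the clique of the edge Upair x y. *)
definition CL :: "nat \<Rightarrow> 'a cl_vertex ugraph \<Rightarrow> 'a cl_vertex ugraph" where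
  "CL n G =
     \<lparr>verts = Old ` verts G \<union> {New e i |e i. e \<in> edges G \<and> i < n - 2},
      edges = {Upair x y |e x y. e \<in> edges G \<and> x \<in> cl_clique n e \<and> y \<in> cl_clique n e \<and> x \<noteq> y}\<rparr>"

definition CL_iter :: "nat \<Rightarrow> nat \<Rightarrow> 'a ugraph \<Rightarrow> 'a cl_vertex ugraph" where
  "CL_iter n r G =
     (CL n ^^ r) \<lparr>verts = Base ` verts G, edges = map_uprod Base ` edges G\<rparr>"

definition step_pmf :: "'v ugraph \<Rightarrow> 'v \<Rightarrow> 'v pmf" where
  "step_pmf G v = pmf_of_set (neighbours G v)"

definition stationary_pmf :: "'v ugraph \<Rightarrow> 'v pmf" where
  "stationary_pmf G = (THE p. set_pmf p \<subseteq> verts G \<and> bind_pmf p (step_pmf G) = p)"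

(* Distribution of the t-th position of the walk started in v, given the earlier positions. *)
definition walk_kernel :: "'v ugraph \<Rightarrow> 'v \<Rightarrow> nat \<Rightarrow> (nat \<Rightarrow> 'v) \<Rightarrow> 'v measure" where
  "walk_kernel G v t \<omega> =
     measure_pmf (if t = 0 then return_pmf v else step_pmf G (\<omega> (t - 1)))"

lemma measurable_walk_kernel:
  "walk_kernel G v t \<in>
     measurable (PiM {0..<t} (\<lambda>_. count_space UNIV)) (subprob_algebra (count_space UNIV))"
proof (cases "t = 0")
  case True
  then have "walk_kernel G v t = (\<lambda>_. measure_pmf (return_pmf v))"
    by (simp add: walk_kernel_def fun_eq_iff)
  moreover have "measure_pmf (return_pmf v) \<in> space (subprob_algebra (count_space UNIV))"
    by (simp add: space_subprob_algebra measure_pmf.subprob_space_axioms)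
  ultimately show ?thesis
    by (simp only: measurable_const)
next
  case False
  then have kernel: "walk_kernel G v t = (\<lambda>\<omega>. measure_pmf (step_pmf G (\<omega> (t - 1))))"
    by (simp add: walk_kernel_def fun_eq_iff)
  have index: "(\<lambda>\<omega>. \<omega> (t - 1)) \<in>
      measurable (PiM {0..<t} (\<lambda>_. count_space UNIV)) (count_space UNIV)"
    by (rule measurable_component_singleton) (use False in simp)
  have step: "(\<lambda>x. measure_pmf (step_pmf G x)) \<in>
      measurable (count_space UNIV) (subprob_algebra (count_space UNIV))"
    by (simp add: space_subprob_algebra measure_pmf.subprob_space_axioms)
  show ?thesis
    unfolding kernel by (rule measurable_compose[OF index step])
qed

interpretation walk: Ionescu_Tulcea "walk_kernel G v" "\<lambda>_. count_space UNIV" for G v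
  by (rule Ionescu_Tulcea.intro[OF measurable_walk_kernel])
    (simp add: walk_kernel_def measure_pmf.prob_space_axioms)

definition walk_measure :: "'v ugraph \<Rightarrow> 'v \<Rightarrow> (nat \<Rightarrow> 'v) measure" where
  "walk_measure G v = walk.PF.lim G v"

(* The infimum is infinite on trajectories that never visit w. *)
definition hitting_time :: "'v \<Rightarrow> (nat \<Rightarrow> 'v) \<Rightarrow> ennreal" where
  "hitting_time w \<omega> = (INF t\<in>{t. \<omega> t = w}. of_nat t)"

definition expected_hitting_time :: "'v ugraph \<Rightarrow> 'v \<Rightarrow> 'v \<Rightarrow> ennreal" where
  "expected_hitting_time G v w = (\<integral>\<^sup>+ \<omega>. hitting_time w \<omega> \<partial>walk_measure G v)"

(* The value does not depend on the initial vertex v when G is finite, simple, connected and has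
   an edge. *)
definition kemeny :: "'v ugraph \<Rightarrow> 'v \<Rightarrow> real" where
  "kemeny G v =
     enn2real (\<integral>\<^sup>+ w. expected_hitting_time G v w \<partial>measure_pmf (stationary_pmf G))"

end

theory Submission
  imports Defs
begin

text \<open>
  Let \<open>H\<close> be the blow-up of a connected graph \<open>G\<close> with vertex set \<open>V\<close> and \<open>m\<close> edges; the vertex
  \<open>x\<close> of \<open>G\<close> has the set \<open>N x\<close> of neighbours and the degree \<open>d x\<close>. Kemeny's constant is computed
  from hitting times, and hitting times from a linear system. For a fixed target \<open>w\<close> the expected
  hitting time \<open>x \<mapsto> h w x\<close> satisfies the Poisson equation
  \<open>(\<Sum>y\<in>N x. f x - f y) = d x - (if x = w then 2 * m else 0)\<close>: away from \<open>w\<close> this is the first-step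
  equation, and at \<open>w\<close> the value is forced because the left-hand side sums to zero over the graph.
  A harmonic function on a connected finite graph is constant, so any solution \<open>f w\<close> of the
  Poisson equation gives \<open>h w x = f w x - f w w\<close>, the stationary distribution is \<open>d w / (2 * m)\<close>,
  and Kemeny's constant is \<open>(\<Sum>w. d w * (f w v - f w w)) / (2 * m)\<close> (lemma \<open>kemeny_eq_poisson\<close>).

  It therefore suffices to guess solutions on \<open>H\<close>. Inside the clique of an edge the equations at
  the new vertices determine their values from those at the two ends. Substituting these values
  into the equation at an old vertex gives \<open>n / 2\<close> times the Laplacian of \<open>G\<close>. So for an old
  target the solution restricted to old vertices is \<open>n - 1\<close> times the hitting time of \<open>G\<close>, and for
  a new target it is \<open>(n - 1) / 2\<close> times the sum of the hitting times to the two ends of its edge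
  (lemma \<open>poisson_potential\<close>). In the resulting sum over all targets the only quantity of \<open>G\<close>
  besides \<open>K(G)\<close>, \<open>card V\<close> and \<open>m\<close> is the sum over the edges of the commute time between their
  ends, and this equals \<open>2 * m * (card V - 1)\<close> for every connected graph (lemma
  \<open>sum_commute_times\<close>). The outcome is lemma \<open>kemeny_CL\<close>:
  \<open>K(H) = (n - 1) * K(G) + (n - 1) * (n - 2) / (2 * n) * (3 * m - card V)\<close>.

  Each step sends \<open>card V\<close> to \<open>card V + (n - 2) * m\<close> and \<open>m\<close> to \<open>n * (n - 1) / 2 * m\<close>, so the
  iterates satisfy a linear recursion whose solution (lemma \<open>iterated_recursion\<close>) is the formula.

  The probabilistic part identifies the expected hitting time on the trajectory space with the sum
  over \<open>t\<close> of the probabilities of not having met the target up to time \<open>t\<close>. These satisfy a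
  first-step recursion and decay geometrically, so the sum is finite.
\<close>

section \<open>Hitting times on the trajectory space\<close>

text \<open>
  The transition operator of the walk that is killed on arrival at \<open>w\<close>; its powers applied to the
  indicator of the complement of \<open>w\<close> are the survival probabilities.
\<close>

definition killed_step :: "'v ugraph \<Rightarrow> 'v \<Rightarrow> ('v \<Rightarrow> ennreal) \<Rightarrow> 'v \<Rightarrow> ennreal" where
  "killed_step G w f x = (if x = w then 0 else \<integral>\<^sup>+ y. f y \<partial>measure_pmf (step_pmf G x))"

text \<open>
  A natural number is the number of times that precede it; the trajectories that avoid \<open>w\<close>
  contribute infinitely many ones, in agreement with the infimum of the empty set.
\<close>

lemma hitting_time_eq_suminf:
  "hitting_time w \<omega> = (\<Sum>t. indicator {\<omega>. \<forall>s\<le>t. \<omega> s \<noteq> w} \<omega>)"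
proof (cases "\<exists>t. \<omega> t = w")
  case False
  then have "hitting_time w \<omega> = \<infinity>"
    by (simp add: hitting_time_def)
  moreover have "(\<Sum>t. indicator {\<omega>. \<forall>s\<le>t. \<omega> s \<noteq> w} \<omega> :: ennreal) = \<infinity>"
  proof -
    have "(\<Sum>t. indicator {\<omega>. \<forall>s\<le>t. \<omega> s \<noteq> w} \<omega> :: ennreal) = (\<Sum>t::nat. 1)"
      using False by (intro suminf_cong) (auto simp: indicator_def)
    also have "\<dots> = \<infinity>"
      by (simp add: suminf_eq_SUP ennreal_SUP_of_nat_eq_top)
    finally show ?thesis .
  qed
  ultimately show ?thesis by simp
next
  case True
  define T where "T = (LEAST t. \<omega> t = w)"
  have T: "\<omega> T = w" "\<And>t. \<omega> t = w \<Longrightarrow> T \<le> t"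
    unfolding T_def using True by (auto intro: LeastI_ex Least_le)
  have "hitting_time w \<omega> = of_nat T"
    unfolding hitting_time_def by (rule antisym) (auto intro!: INF_lower2[of T] INF_greatest
        simp: T)
  moreover have "indicator {\<omega>. \<forall>s\<le>t. \<omega> s \<noteq> w} \<omega> = (if t < T then 1 else 0 :: ennreal)" for t
    using T by (force simp: indicator_def not_less)
  then have "(\<Sum>t. indicator {\<omega>. \<forall>s\<le>t. \<omega> s \<noteq> w} \<omega> :: ennreal) = (\<Sum>t<T. 1)"
    by (subst suminf_finite[of "{..<T}"]) auto
  ultimately show ?thesis by simp
qed

text \<open>
  Quantities that depend on finitely many steps only can be integrated against the iterated kernel
  \<open>walk.C\<close>, which has a recursive description in contrast to the projective limit.
\<close>

lemma nn_integral_walk_prefix: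
  assumes [measurable]: "f \<in> borel_measurable (PiM {0..<t} (\<lambda>_. count_space UNIV))"
  shows "(\<integral>\<^sup>+\<omega>. f (restrict \<omega> {0..<t}) \<partial>walk_measure G v)
      = (\<integral>\<^sup>+\<omega>. f \<omega> \<partial>walk.C G v 0 t (\<lambda>_. undefined))"
proof -
  have "(\<integral>\<^sup>+\<omega>. f (restrict \<omega> {0..<t}) \<partial>walk_measure G v)
      = (\<integral>\<^sup>+\<omega>. f \<omega> \<partial>distr (walk.PF.lim G v) (PiM {0..<t} (\<lambda>_. count_space UNIV)) (\<lambda>\<omega>. restrict \<omega>
          {0..<t}))"
    unfolding walk_measure_def
    by (subst nn_integral_distr)
      (auto intro!: measurable_restrict simp: measurable_cong_sets[OF walk.PF.sets_lim refl])
  also have "\<dots> = (\<integral>\<^sup>+\<omega>. f \<omega> \<partial>walk.CI G v {0..<t})"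
    by (simp add: walk.distr_lim)
  also have "walk.up_to {0..<t} = t"
    by (rule antisym, simp_all add: walk.up_to_iff_Ico) (metis atLeastLessThan_iff
        finite_atLeastLessThan leI le0 less_irrefl walk.up_to_less)
  then have "walk.CI G v {0..<t} = distr (walk.C G v 0 t (\<lambda>_. undefined)) (PiM {0..<t} (\<lambda>_.
      count_space UNIV)) (\<lambda>\<omega>. restrict \<omega> {0..<0+t})"
    by (simp add: walk.CI_def)
  also have "\<dots> = walk.C G v 0 t (\<lambda>_. undefined)"
    using walk.distr_C[of t t "\<lambda>_. undefined" 0 G v] by simp
  finally show ?thesis .
qed

lemma measurable_at_time:
  assumes "t \<in> J"
  shows "(\<lambda>\<omega>. f (\<omega> t)) \<in> measurable (PiM J (\<lambda>_. count_space UNIV)) (count_space UNIV)"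
  using measurable_component_singleton[OF assms, of "\<lambda>_. count_space UNIV"]
  by (rule measurable_compose) simp

text \<open>
  Writing the event as a finite product of coordinate indicators makes its measurability
  independent of the cardinality of the vertex type.
\<close>

lemma measurable_killed_value:
  assumes "{..t} \<subseteq> J"
  shows "(\<lambda>\<omega>. f (\<omega> t) * indicator {\<omega>. \<forall>s\<le>t::nat. \<omega> s \<noteq> w} \<omega> :: ennreal)
    \<in> borel_measurable (PiM J (\<lambda>_. count_space UNIV))"
proof -
  have "(\<lambda>\<omega>. f (\<omega> t)) \<in> borel_measurable (PiM J (\<lambda>_. count_space UNIV))"
    by (rule measurable_compose[OF measurable_at_time[where f = id, unfolded id_def]])
      (use assms in auto)
  moreover have "(\<lambda>\<omega>. \<Prod>s\<le>t. indicator (- {w}) (\<omega> s) :: ennreal) \<in> borel_measurable (PiM J (\<lambda>_.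
      count_space UNIV))"
    by (intro borel_measurable_prod_ennreal measurable_compose[OF measurable_at_time[where f
        = id, unfolded id_def]])
      (use assms in auto)
  moreover have "indicator {\<omega>. \<forall>s\<le>t. \<omega> s \<noteq> w} \<omega> = (\<Prod>s\<le>t. indicator (- {w}) (\<omega> s) :: ennreal)" for \<omega>
    by (cases "\<forall>s\<le>t. \<omega> s \<noteq> w") (auto simp: indicator_def)
  ultimately show ?thesis by simp
qed

text \<open>
  The Markov property for the killed walk. The kernel \<open>walk.C\<close> adds steps at the end of a
  trajectory, while the hitting time equation conditions on the first step. Quantifying over all
  \<open>f\<close> bridges the two: integrating out the last step replaces \<open>f\<close> by \<open>killed_step G w f\<close>, and
  powers of one operator can be unfolded on either side.
\<close>

lemma nn_integral_killed_walk:
  fixes w :: 'v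
  assumes "f w = 0"
  shows "(\<integral>\<^sup>+\<omega>. f (\<omega> t) * indicator {\<omega>. \<forall>s\<le>t. \<omega> s \<noteq> w} \<omega> \<partial>walk.C G v 0 (Suc t) (\<lambda>_. undefined))
    = (killed_step G w ^^ t) f v"
  using assms
proof (induction t arbitrary: f)
  case 0
  have "(\<lambda>\<omega>. f (\<omega> 0) * indicator {\<omega>. \<omega> 0 \<noteq> w} \<omega>) \<in> borel_measurable (PiM {0..<Suc 0} (\<lambda>_.
      count_space UNIV))"
    using measurable_killed_value[of 0 "{0..<Suc 0}" f w] by simp
  note meas = this
  have "(\<integral>\<^sup>+\<omega>. f (\<omega> 0) * indicator {\<omega>. \<forall>s\<le>0. \<omega> s \<noteq> w} \<omega> \<partial>walk.C G v 0 (Suc 0) (\<lambda>_. undefined))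
     = (\<integral>\<^sup>+\<omega>. f (\<omega> 0) * indicator {\<omega>. \<omega> 0 \<noteq> w} \<omega> \<partial>walk.eP G v 0 (\<lambda>_. undefined))"
    using bind_return[OF walk.measurable_eP[of G v 0], of "\<lambda>_. undefined"] by simp
  also have "\<dots> = f v * indicator {x. x \<noteq> w} v"
    by (subst walk.nn_integral_eP[OF _ meas]) (simp_all add: walk_kernel_def nn_integral_return
        indicator_def)
  finally show ?case using 0 by (auto simp: indicator_def)
next
  case (Suc t)
  let ?M = "\<lambda>t. PiM {0..<t} (\<lambda>_. count_space (UNIV::'v set))"
  have "sets (walk.C G v 0 (Suc t) (\<lambda>_. undefined)) = sets (?M (0 + Suc t))"
    by (rule walk.sets_C) simp
  note cong = measurable_cong_sets[OF this refl]
  have kernel: "walk.eP G v (Suc t) \<in> measurable (walk.C G v 0 (Suc t) (\<lambda>_. undefined))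
      (subprob_algebra (?M (Suc (Suc t))))"
    using walk.measurable_eP[of G v "Suc t"] unfolding cong by (simp only: add_0)
  have meas: "(\<lambda>\<omega>. f (\<omega> (Suc t)) * indicator {\<omega>. \<forall>s\<le>Suc t. \<omega> s \<noteq> w} \<omega>) \<in> borel_measurable (?M
      (Suc (Suc t)))"
    by (rule measurable_killed_value) auto
  have "(\<integral>\<^sup>+\<omega>. f (\<omega> (Suc t)) * indicator {\<omega>. \<forall>s\<le>Suc t. \<omega> s \<noteq> w} \<omega> \<partial>walk.C G v 0 (Suc (Suc t))
      (\<lambda>_. undefined))
     = (\<integral>\<^sup>+\<omega>. (\<integral>\<^sup>+\<omega>'. f (\<omega>' (Suc t)) * indicator {\<omega>. \<forall>s\<le>Suc t. \<omega> s \<noteq> w} \<omega>' \<partial>walk.eP G v (Suc t)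
         \<omega>) \<partial>walk.C G v 0 (Suc t) (\<lambda>_. undefined))"
    unfolding walk.C.simps(2)[of G v 0 "Suc t"] add_0 by (rule nn_integral_bind[OF meas kernel])
  also have "\<dots> = (\<integral>\<^sup>+\<omega>. killed_step G w f (\<omega> t) * indicator {\<omega>. \<forall>s\<le>t. \<omega> s \<noteq> w} \<omega> \<partial>walk.C G v 0
      (Suc t) (\<lambda>_. undefined))"
  proof (rule nn_integral_cong)
    fix \<omega> assume "\<omega> \<in> space (walk.C G v 0 (Suc t) (\<lambda>_. undefined))"
    then have \<omega>: "\<omega> \<in> space (?M (Suc t))"
      by (simp add: walk.space_C del: walk.C.simps)
    have "(\<integral>\<^sup>+\<omega>'. f (\<omega>' (Suc t)) * indicator {\<omega>. \<forall>s\<le>Suc t. \<omega> s \<noteq> w} \<omega>' \<partial>walk.eP G v (Suc t) \<omega>)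
      = (\<integral>\<^sup>+y. f y * indicator {\<omega>. \<forall>s\<le>t. \<omega> s \<noteq> w} \<omega> \<partial>measure_pmf (step_pmf G (\<omega> t)))"
    proof -
      have "f y * indicator {\<omega>. \<forall>s\<le>Suc t. \<omega> s \<noteq> w} (fun_upd \<omega> (Suc t) y)
          = f y * indicator {\<omega>. \<forall>s\<le>t. \<omega> s \<noteq> w} \<omega>" for y
        using Suc.prems by (cases "y = w") (auto simp: indicator_def le_Suc_eq)
      then show ?thesis
        by (subst walk.nn_integral_eP[OF \<omega> meas]) (simp add: walk_kernel_def)
    qed
    also have "\<dots> = killed_step G w f (\<omega> t) * indicator {\<omega>. \<forall>s\<le>t. \<omega> s \<noteq> w} \<omega>"
      by (auto simp: killed_step_def indicator_def)
    finally show "(\<integral>\<^sup>+\<omega>'. f (\<omega>' (Suc t)) * indicator {\<omega>. \<forall>s\<le>Suc t. \<omega> s \<noteq> w} \<omega>' \<partial>walk.eP G v (Suc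
        t) \<omega>)
      = killed_step G w f (\<omega> t) * indicator {\<omega>. \<forall>s\<le>t. \<omega> s \<noteq> w} \<omega>" .
  qed
  also have "\<dots> = (killed_step G w ^^ t) (killed_step G w f) v"
    by (rule Suc.IH) (simp add: killed_step_def)
  finally show ?case by (simp only: funpow_Suc_right o_def)
qed

text \<open>
  The tail sum formula for the expectation of a natural number valued random variable.
\<close>

lemma expected_hitting_time_eq_suminf:
  "expected_hitting_time G v w = (\<Sum>t. (killed_step G w ^^ t) (indicator (- {w})) v)"
proof -
  have "expected_hitting_time G v w = (\<Sum>t. \<integral>\<^sup>+\<omega>. indicator {\<omega>. \<forall>s\<le>t. \<omega> s \<noteq> w} \<omega> \<partial>walk_measure G v)"
    unfolding expected_hitting_time_def hitting_time_eq_suminf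
  proof (rule nn_integral_suminf)
    fix t
    have "indicator {\<omega>. \<forall>s\<le>t. \<omega> s \<noteq> w} \<in> borel_measurable (PiM UNIV (\<lambda>_. count_space UNIV) ::
        (nat \<Rightarrow> 'a) measure)"
      using measurable_killed_value[of t UNIV "\<lambda>_. 1" w]
          by (simp del: borel_measurable_indicator_iff)
    then show "indicator {\<omega>. \<forall>s\<le>t. \<omega> s \<noteq> w} \<in> borel_measurable (walk_measure G v)"
      unfolding walk_measure_def measurable_cong_sets[OF walk.PF.sets_lim refl] .
  qed
  moreover have "(\<integral>\<^sup>+\<omega>. indicator {\<omega>. \<forall>s\<le>t. \<omega> s \<noteq> w} \<omega> \<partial>walk_measure G v)
     = (killed_step G w ^^ t) (indicator (- {w})) v" for t
  proof -
    have "(\<integral>\<^sup>+\<omega>. indicator {\<omega>. \<forall>s\<le>t. \<omega> s \<noteq> w} \<omega> \<partial>walk_measure G v)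
       = (\<integral>\<^sup>+\<omega>. indicator (- {w}) (\<omega> t) * indicator {\<omega>. \<forall>s\<le>t. \<omega> s \<noteq> w} \<omega> \<partial>walk.C G v 0 (Suc t)
           (\<lambda>_. undefined))"
      by (subst nn_integral_walk_prefix[symmetric], rule measurable_killed_value)
        (auto intro!: nn_integral_cong simp: indicator_def)
    then show ?thesis
      by (simp add: nn_integral_killed_walk del: walk.C.simps)
  qed
  ultimately show ?thesis by simp
qed

section \<open>Connected graphs and harmonic functions\<close>

locale walk_graph =
  fixes G :: "'v ugraph"
  assumes simple: "finite_simple_graph G"
    and connected: "connected_graph G"
    and nonempty: "edges G \<noteq> {}"
begin

abbreviation V :: "'v set" where "V \<equiv> verts G"
abbreviation N :: "'v \<Rightarrow> 'v set" where "N \<equiv> neighbours G"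
abbreviation d :: "'v \<Rightarrow> real" where "d x \<equiv> real (card (N x))"
abbreviation m :: real where "m \<equiv> real (card (edges G))"

lemma finite_verts [simp]: "finite V"
  using simple by (simp add: finite_simple_graph_def)

lemma Upair_edgeD:
  assumes "Upair x y \<in> edges G"
  shows "x \<in> V" "y \<in> V" "x \<noteq> y"
proof -
  have "proper_uprod (Upair x y) \<and> set_uprod (Upair x y) \<subseteq> V"
    using simple assms unfolding finite_simple_graph_def by blast
  then show "x \<in> V" "y \<in> V" "x \<noteq> y" by simp_all
qed

lemma neighbours_in_verts: "y \<in> N x \<Longrightarrow> y \<in> V" "y \<in> N x \<Longrightarrow> x \<in> V"
  using Upair_edgeD by (simp_all add: neighbours_def)

lemma neighbours_sym: "y \<in> N x \<longleftrightarrow> x \<in> N y"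
proof -
  have "Upair y x = Upair x y" by simp
  then show ?thesis unfolding neighbours_def mem_Collect_eq by (simp only:)
qed

lemma not_neighbour_self [simp]: "x \<notin> N x"
  using Upair_edgeD(3)[of x x] by (auto simp: neighbours_def)

lemma edge_cases:
  assumes "e \<in> edges G"
  obtains x y where "e = Upair x y" "x \<in> V" "y \<in> V" "x \<noteq> y" "y \<in> N x" "x \<in> N y"
proof (cases e)
  case (Upair x y)
  with assms have "y \<in> N x" by (simp add: neighbours_def)
  then show ?thesis
    using that[of x y] Upair Upair_edgeD[of x y] assms neighbours_sym[of y x] by simp
qed

lemma finite_neighbours [simp]: "finite (N x)"
  using neighbours_in_verts finite_subset[OF _ finite_verts] by blast

lemma finite_edges [simp]: "finite (edges G)"
proof (rule finite_subset)
  show "edges G \<subseteq> (\<lambda>(x, y). Upair x y) ` (V \<times> V)"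
  proof
    fix e assume "e \<in> edges G"
    then obtain x y where "e = Upair x y" "x \<in> V" "y \<in> V" by (rule edge_cases)
    then show "e \<in> (\<lambda>(x, y). Upair x y) ` (V \<times> V)" by force
  qed
qed simp

lemma m_pos: "m > 0"
  using nonempty by (simp add: card_gt_0_iff)

text \<open>
  Connectedness as an induction principle: a property that passes to neighbours spreads from one
  vertex to all.
\<close>

lemma connected_induct [consumes 2, case_names base step]:
  assumes "x \<in> V" "y \<in> V" "P x" "\<And>y z. y \<in> V \<Longrightarrow> P y \<Longrightarrow> z \<in> N y \<Longrightarrow> P z"
  shows "P y"
proof -
  have "(x, y) \<in> {(x, y). Upair x y \<in> edges G}\<^sup>*"
    using connected assms(1,2) unfolding connected_graph_def by blast
  then have "y \<in> V \<and> P y"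
  proof (induction rule: rtrancl_induct)
    case base
    with assms(1,3) show ?case by blast
  next
    case (step y z)
    then have "z \<in> N y" by (simp add: neighbours_def)
    with step.IH assms(4) neighbours_in_verts(1) show ?case by blast
  qed
  then show ?thesis ..
qed

text \<open>
  The edge guaranteed by \<open>nonempty\<close> excludes the graph with a single vertex, where the walk has no
  step to take.
\<close>

lemma neighbours_nonempty:
  assumes "x \<in> V"
  shows "N x \<noteq> {}"
proof
  assume empty: "N x = {}"
  obtain e where "e \<in> edges G" using nonempty by blast
  then obtain a b where ab: "a \<in> V" "b \<in> N a" by (rule edge_cases)
  from assms ab(1) have "a = x"
    by (induction rule: connected_induct) (use empty in auto)
  with ab empty show False by simp
qed

lemma d_pos: "x \<in> V \<Longrightarrow> d x > 0"
  using neighbours_nonempty by (simp add: card_gt_0_iff)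

text \<open>
  The pairs \<open>(x, y)\<close> with \<open>y \<in> N x\<close> are the darts, or oriented edges; reversing all of them is a
  bijection.
\<close>

lemma sum_darts_swap:
  fixes F :: "'v \<Rightarrow> 'v \<Rightarrow> real"
  shows "(\<Sum>x\<in>V. \<Sum>y\<in>N x. F x y) = (\<Sum>x\<in>V. \<Sum>y\<in>N x. F y x)"
proof -
  have N: "N x = {y \<in> V. y \<in> N x}" "N x = {y \<in> V. x \<in> N y}" for x
    using neighbours_in_verts neighbours_sym by blast+
  have "(\<Sum>x\<in>V. \<Sum>y\<in>N x. F x y) = (\<Sum>x\<in>V. \<Sum>y | y \<in> V \<and> y \<in> N x. F x y)"
    by (subst N(1)) (rule refl)
  also have "\<dots> = (\<Sum>y\<in>V. \<Sum>x | x \<in> V \<and> y \<in> N x. F x y)"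
    by (rule sum.swap_restrict) simp_all
  also have "\<dots> = (\<Sum>y\<in>V. \<Sum>x\<in>N y. F x y)"
    by (subst (2) N(2)) (rule refl)
  finally show ?thesis .
qed

text \<open>
  Each edge carries two darts. With the constant function this is the handshake lemma \<open>sum_d\<close>
  below.
\<close>

lemma sum_darts_eq_sum_edges:
  fixes \<phi> :: "'v uprod \<Rightarrow> real"
  shows "(\<Sum>x\<in>V. \<Sum>y\<in>N x. \<phi> (Upair x y)) = 2 * (\<Sum>e\<in>edges G. \<phi> e)"
proof -
  let ?D = "Sigma V N" and ?u = "\<lambda>(x, y). Upair x y"
  have img: "?u ` ?D = edges G"
  proof
    show "?u ` ?D \<subseteq> edges G" by (auto simp: neighbours_def)
    show "edges G \<subseteq> ?u ` ?D"
    proof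
      fix e assume "e \<in> edges G"
      then obtain x y where "e = Upair x y" "x \<in> V" "y \<in> N x" by (rule edge_cases)
      then show "e \<in> ?u ` ?D" by (intro image_eqI[of _ _ "(x, y)"]) auto
    qed
  qed
  have fib: "card {p \<in> ?D. ?u p = e} = 2" if "e \<in> edges G" for e
  proof -
    from that obtain x y where xy: "e = Upair x y" "x \<in> V" "y \<in> V" "x \<noteq> y" "y \<in> N x" "x \<in> N y"
      by (rule edge_cases)
    then have "{p \<in> ?D. ?u p = e} = {(x, y), (y, x)}"
      by auto
    with xy show ?thesis by simp
  qed
  have "(\<Sum>x\<in>V. \<Sum>y\<in>N x. \<phi> (Upair x y)) = (\<Sum>p\<in>?D. \<phi> (?u p))"
    by (subst sum.Sigma) (auto simp: split_def)
  also have "\<dots> = (\<Sum>e\<in>?u ` ?D. \<Sum>p | p \<in> ?D \<and> ?u p = e. \<phi> (?u p))"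
    by (rule sum.image_gen) simp
  also have "\<dots> = (\<Sum>e\<in>edges G. \<Sum>p\<in>{p \<in> ?D. ?u p = e}. \<phi> e)"
    unfolding img by (intro sum.cong) auto
  also have "\<dots> = 2 * (\<Sum>e\<in>edges G. \<phi> e)"
    by (simp add: fib sum_distrib_left cong: sum.cong)
  finally show ?thesis .
qed

lemma sum_d: "(\<Sum>x\<in>V. d x) = 2 * m"
  using sum_darts_eq_sum_edges[of "\<lambda>_. 1"] by simp

text \<open>
  The maximum principle: where the maximum is attained, the nonnegative differences to the
  neighbours sum to zero, so the neighbours attain it too.
\<close>

lemma harmonic_constant:
  assumes harm: "\<And>x. x \<in> V \<Longrightarrow> (\<Sum>y\<in>N x. f x - f y) = (0::real)"
    and "x \<in> V" "y \<in> V"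
  shows "f x = f y"
proof -
  define M where "M = Max (f ` V)"
  have le: "f z \<le> M" if "z \<in> V" for z
    using that by (simp add: M_def)
  have "M \<in> f ` V"
    unfolding M_def using \<open>x \<in> V\<close> by (intro Max_in) auto
  then obtain x0 where x0: "x0 \<in> V" "f x0 = M" by auto
  have "f z = M" if "z \<in> V" for z
    using x0(1) that
  proof (induction rule: connected_induct)
    case base show ?case by (fact x0(2))
  next
    case (step y z)
    have "(\<Sum>y'\<in>N y. M - f y') = 0"
      using harm[OF step(1)] by (simp only: step(3))
    then have "\<forall>y'\<in>N y. M - f y' = 0"
      by (subst (asm) sum_nonneg_eq_0_iff) (use le neighbours_in_verts in auto)
    with step(2) show ?case by simp
  qed
  with assms show ?thesis by simp
qed

text \<open>
  The Poisson equation of the graph Laplacian with a unit of mass per dart spread over the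
  vertices and the total mass \<open>2 * m\<close> removed at \<open>w\<close>. The right-hand side has sum zero, as
  solvability requires.
\<close>

definition poisson :: "'v \<Rightarrow> ('v \<Rightarrow> real) \<Rightarrow> bool" where
  "poisson w f \<longleftrightarrow> (\<forall>x\<in>V. (\<Sum>y\<in>N x. f x - f y) = d x - (if x = w then 2 * m else 0))"

text \<open>
  Two solutions differ by a harmonic function, that is, by a constant.
\<close>

lemma poisson_unique:
  assumes "poisson w f" "poisson w g" "x \<in> V" "w \<in> V"
  shows "f x - f w = g x - g w"
proof -
  have "f x - g x = f w - g w"
  proof (rule harmonic_constant[of "\<lambda>x. f x - g x"])
    fix x assume "x \<in> V"
    then have "(\<Sum>y\<in>N x. f x - f y) - (\<Sum>y\<in>N x. g x - g y) = 0"
      using assms(1,2) by (simp add: poisson_def)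
    then show "(\<Sum>y\<in>N x. f x - g x - (f y - g y)) = 0"
      unfolding sum_subtractf by linarith
  qed fact+
  then show ?thesis by simp
qed

section \<open>Hitting times solve the Poisson equation\<close>

text \<open>
  The probability that the walk from \<open>x\<close> avoids \<open>w\<close> at the times \<open>0, \<dots>, t\<close>, as given by
  conditioning on the first step.
\<close>

fun survival :: "'v \<Rightarrow> nat \<Rightarrow> 'v \<Rightarrow> real" where
  "survival w 0 x = (if x = w then 0 else 1)"
| "survival w (Suc t) x = (if x = w then 0 else (\<Sum>y\<in>N x. survival w t y) / d x)"

lemma nn_integral_step:
  assumes "x \<in> V" "\<And>y. y \<in> V \<Longrightarrow> 0 \<le> f y"
    and "\<And>y. y \<in> V \<Longrightarrow> g y = ennreal (f y)"
  shows "(\<integral>\<^sup>+ y. g y \<partial>measure_pmf (step_pmf G x)) = ennreal ((\<Sum>y\<in>N x. f y) / d x)"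
proof -
  have "(\<integral>\<^sup>+ y. g y \<partial>measure_pmf (step_pmf G x)) = (\<Sum>y\<in>N x. ennreal (f y)) / ennreal (d x)"
    unfolding step_pmf_def using neighbours_nonempty[OF assms(1)] neighbours_in_verts assms(3)
    by (subst nn_integral_pmf_of_set) (auto simp: ennreal_of_nat_eq_real_of_nat cong: sum.cong)
  also have "\<dots> = ennreal ((\<Sum>y\<in>N x. f y) / d x)"
    using assms neighbours_in_verts d_pos[OF assms(1)]
    by (subst sum_ennreal) (auto intro!: divide_ennreal sum_nonneg)
  finally show ?thesis .
qed

lemma survival_nonneg: "0 \<le> survival w t x"
  by (induction t arbitrary: x) (auto intro!: divide_nonneg_nonneg sum_nonneg)

lemma killed_walk_eq_survival:
  "x \<in> V \<Longrightarrow> (killed_step G w ^^ t) (indicator (- {w})) x = ennreal (survival w t x)"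
proof (induction t arbitrary: x)
  case (Suc t)
  have "(\<integral>\<^sup>+ y. (killed_step G w ^^ t) (indicator (- {w})) y \<partial>measure_pmf (step_pmf G x))
      = ennreal ((\<Sum>y\<in>N x. survival w t y) / d x)"
    by (rule nn_integral_step[OF Suc.prems survival_nonneg Suc.IH])
  then show ?case
    by (simp add: killed_step_def[of G w "(killed_step G w ^^ t) (indicator (- {w}))"])
qed simp

lemma average_le:
  assumes "x \<in> V" "\<And>y. y \<in> N x \<Longrightarrow> f y \<le> (c::real)"
  shows "(\<Sum>y\<in>N x. f y) / d x \<le> c"
  using sum_bounded_above[of "N x" f c] assms d_pos[OF assms(1)] by (simp add: field_simps)

lemma survival_decreasing: "x \<in> V \<Longrightarrow> survival w (Suc t) x \<le> survival w t x"
proof (induction t arbitrary: x)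
  case 0
  have "\<And>y. survival w 0 y \<le> 1" by simp
  then show ?case using average_le[OF 0, of "survival w 0" 1] by simp
next
  case (Suc t)
  then show ?case using d_pos[of x] neighbours_in_verts
    by (subst (1 2) survival.simps(2)) (auto intro!: divide_right_mono sum_mono simp del:
        survival.simps)
qed

lemma survival_antimono: "x \<in> V \<Longrightarrow> s \<le> t \<Longrightarrow> survival w t x \<le> survival w s x"
  using lift_Suc_antimono_le[of "\<lambda>t. survival w t x"] survival_decreasing by blast

lemma survival_le_1: "x \<in> V \<Longrightarrow> survival w t x \<le> 1"
  using survival_antimono[of x 0 t w] by (simp split: if_splits)

text \<open>
  A path from \<open>x\<close> to \<open>w\<close> is followed with positive probability: if \<open>y\<close> can be absorbed within \<open>t\<close>
  steps, then each neighbour of \<open>y\<close> can within \<open>t + 1\<close>.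
\<close>

lemma survival_eventually_less_1:
  assumes "w \<in> V" "x \<in> V"
  shows "\<exists>t. survival w t x < 1"
  using assms
proof (induction rule: connected_induct)
  case base
  show ?case by (rule exI[of _ 0]) simp
next
  case (step y z)
  then obtain t where t: "survival w t y < 1" by blast
  have z: "z \<in> V" and yz: "y \<in> N z"
    using step neighbours_in_verts neighbours_sym by blast+
  have "(\<Sum>y\<in>N z. survival w t y) < (\<Sum>y\<in>N z. 1)"
    using t yz survival_le_1 neighbours_in_verts(1) by (intro sum_strict_mono_ex1) auto
  then have "survival w (Suc t) z < 1"
    using d_pos[OF z] by simp
  then show ?case ..
qed

text \<open>
  As the graph is finite, one number \<open>L\<close> of steps and one bound \<open>c < 1\<close> serve all starting points,
  and then \<open>L\<close> further steps multiply the survival probability by at most \<open>c\<close>.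
\<close>

lemma survival_geometric:
  assumes "w \<in> V"
  shows "\<exists>L c. 0 \<le> c \<and> c < 1 \<and> (\<forall>x\<in>V. \<forall>t. survival w (t + L) x \<le> c * survival w t x)"
proof -
  obtain T where T: "\<And>x. x \<in> V \<Longrightarrow> survival w (T x) x < 1"
    using survival_eventually_less_1[OF assms] by metis
  define L where "L = Max (T ` V)"
  define c where "c = Max (survival w L ` V)"
  have L: "survival w L x < 1" if "x \<in> V" for x
    using survival_antimono[of x "T x" L w] T[of x] that by (simp add: L_def)
  have le: "survival w L x \<le> c" if "x \<in> V" for x
    unfolding c_def using that by (intro Max_ge) auto
  have "c \<in> survival w L ` V"
    unfolding c_def using assms by (intro Max_in) auto
  have "0 \<le> c"
    using le[OF assms] survival_nonneg[of w L w] by linarith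
  moreover have "c < 1"
    using L \<open>c \<in> survival w L ` V\<close> by auto
  moreover have "survival w (t + L) x \<le> c * survival w t x" if "x \<in> V" for x t
    using that
  proof (induction t arbitrary: x)
    case 0
    then show ?case
      using le[of x] by (cases L) auto
  next
    case (Suc t)
    have "(\<Sum>y\<in>N x. survival w (t + L) y) \<le> c * (\<Sum>y\<in>N x. survival w t y)"
      unfolding sum_distrib_left using Suc.IH neighbours_in_verts by (intro sum_mono) blast
    then show ?case
      using d_pos[OF Suc.prems] by (simp add: divide_right_mono)
  qed
  ultimately show ?thesis by blast
qed

text \<open>
  Shifting the partial sum \<open>S\<close> by \<open>L\<close> gives \<open>S \<le> L + c * S\<close>, which bounds \<open>S\<close> by \<open>L / (1 - c)\<close>.
\<close>

lemma summable_survival: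
  assumes "w \<in> V" "x \<in> V"
  shows "summable (\<lambda>t. survival w t x)"
proof -
  obtain L c where c: "0 \<le> c" "c < 1"
    and geo: "\<forall>x\<in>V. \<forall>t. survival w (t + L) x \<le> c * survival w t x"
    using survival_geometric[OF assms(1)] by blast
  have "(\<Sum>t<k. survival w t x) \<le> L / (1 - c)" for k
  proof -
    have "(\<Sum>t<k. survival w t x) \<le> (\<Sum>t<k + L. survival w t x)"
      by (intro sum_mono2) (auto simp: survival_nonneg)
    also have "\<dots> = (\<Sum>t<L. survival w t x) + (\<Sum>t<k. survival w (t + L) x)"
      by (induction k) simp_all
    also have "\<dots> \<le> L + c * (\<Sum>t<k. survival w t x)"
    proof (rule add_mono)
      show "(\<Sum>t<L. survival w t x) \<le> L"
        using sum_mono[of "{..<L}" "\<lambda>t. survival w t x" "\<lambda>_. 1"] survival_le_1[OF assms(2)] by simp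
      show "(\<Sum>t<k. survival w (t + L) x) \<le> c * (\<Sum>t<k. survival w t x)"
        unfolding sum_distrib_left using geo assms(2) by (intro sum_mono) blast
    qed
    finally show ?thesis using c by (simp add: field_simps)
  qed
  then show ?thesis
    by (intro summableI_nonneg_bounded survival_nonneg)
qed

definition hit :: "'v \<Rightarrow> 'v \<Rightarrow> real" where
  "hit w x = (\<Sum>t. survival w t x)"

lemma hit_nonneg: "w \<in> V \<Longrightarrow> x \<in> V \<Longrightarrow> 0 \<le> hit w x"
  unfolding hit_def by (intro suminf_nonneg summable_survival survival_nonneg)

lemma expected_hitting_time_eq_hit:
  assumes "w \<in> V" "x \<in> V"
  shows "expected_hitting_time G x w = ennreal (hit w x)"
  using assms
  by (simp add: expected_hitting_time_eq_suminf killed_walk_eq_survival hit_def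
      suminf_ennreal2 survival_nonneg summable_survival)

lemma hit_self [simp]: "hit w w = 0"
proof -
  have "survival w t w = 0" for t by (cases t) auto
  then show ?thesis by (simp add: hit_def)
qed

lemma hit_first_step:
  assumes "w \<in> V" "x \<in> V" "x \<noteq> w"
  shows "hit w x = 1 + (\<Sum>y\<in>N x. hit w y) / d x"
proof -
  have s: "summable (\<lambda>t. survival w t y)" if "y \<in> N x" for y
    using summable_survival assms(1) neighbours_in_verts(1)[OF that] by blast
  have "hit w x = survival w 0 x + (\<Sum>t. survival w (Suc t) x)"
    unfolding hit_def using suminf_split_head[OF summable_survival[OF assms(1,2)]] by simp
  also have "(\<Sum>t. survival w (Suc t) x) = (\<Sum>y\<in>N x. hit w y) / d x"
    using assms(3) s by (simp add: hit_def suminf_divide summable_sum suminf_sum)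
  finally show ?thesis using assms(3) by simp
qed

text \<open>
  Away from \<open>w\<close> this is the first-step equation. At \<open>w\<close> it says that the mean return time is
  \<open>2 * m / d w\<close>, which follows because the Laplacian of any function sums to zero over the
  vertices.
\<close>

lemma poisson_hit:
  assumes "w \<in> V"
  shows "poisson w (hit w)"
proof -
  define L where "L x = (\<Sum>y\<in>N x. hit w x - hit w y)" for x
  have L: "L x = d x" if "x \<in> V" "x \<noteq> w" for x
    using hit_first_step[OF assms that] d_pos[OF that(1)]
    by (simp add: L_def sum_subtractf field_simps)
  have "(\<Sum>x\<in>V. L x) = (\<Sum>x\<in>V. \<Sum>y\<in>N x. hit w x) - (\<Sum>x\<in>V. \<Sum>y\<in>N x. hit w y)"
    by (simp add: L_def sum_subtractf)
  also have "\<dots> = 0"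
    using sum_darts_swap[of "\<lambda>x y. hit w x"] by simp
  finally have "L w + (\<Sum>x\<in>V - {w}. L x) = 0"
    using assms by (simp add: sum.remove)
  moreover have "(\<Sum>x\<in>V - {w}. L x) = (\<Sum>x\<in>V - {w}. d x)"
    using L by (intro sum.cong) auto
  moreover have "\<dots> = 2 * m - d w"
    using sum_d assms by (simp add: sum.remove)
  ultimately have "L w = d w - 2 * m" by simp
  with L show ?thesis by (auto simp: poisson_def L_def)
qed

text \<open>
  Every vertex \<open>x\<close> is an end of \<open>d x\<close> edges.
\<close>

lemma sum_edges_endpoints: "(\<Sum>e\<in>edges G. \<Sum>a\<in>set_uprod e. \<phi> a) = (\<Sum>x\<in>V. d x * (\<phi> x :: real))"
proof -
  have "2 * (\<Sum>e\<in>edges G. \<Sum>a\<in>set_uprod e. \<phi> a) = (\<Sum>x\<in>V. \<Sum>y\<in>N x. \<Sum>a\<in>set_uprod (Upair x y). \<phi> a)"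
    by (rule sum_darts_eq_sum_edges[symmetric])
  also have "\<dots> = (\<Sum>x\<in>V. \<Sum>y\<in>N x. \<phi> x + \<phi> y)"
  proof (intro sum.cong refl)
    fix x y assume "y \<in> N x"
    then have "x \<noteq> y" by auto
    then show "(\<Sum>a\<in>set_uprod (Upair x y). \<phi> a) = \<phi> x + \<phi> y" by simp
  qed
  also have "\<dots> = (\<Sum>x\<in>V. \<Sum>y\<in>N x. \<phi> x) + (\<Sum>x\<in>V. \<Sum>y\<in>N x. \<phi> y)"
    by (simp only: sum.distrib)
  also have "(\<Sum>x\<in>V. \<Sum>y\<in>N x. \<phi> y) = (\<Sum>x\<in>V. \<Sum>y\<in>N x. \<phi> x)"
    by (rule sum_darts_swap)
  finally show ?thesis by simp
qed

text \<open>
  Foster's theorem in terms of commute times. The terms of an edge with \<open>a = b\<close> vanish, so the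
  inner double sum is the commute time between its ends. The total over the edges is the sum of
  \<open>hit x y\<close> over all darts, and for fixed \<open>x\<close> the Poisson equation at the target \<open>x\<close> itself
  evaluates it to \<open>2 * m - d x\<close>.
\<close>

lemma sum_commute_times:
  "(\<Sum>e\<in>edges G. \<Sum>a\<in>set_uprod e. \<Sum>b\<in>set_uprod e. hit b a) = 2 * m * (real (card V) - 1)"
proof -
  let ?c = "\<lambda>e. \<Sum>a\<in>set_uprod e. \<Sum>b\<in>set_uprod e. hit b a"
  have "2 * (\<Sum>e\<in>edges G. ?c e) = (\<Sum>x\<in>V. \<Sum>y\<in>N x. ?c (Upair x y))"
    by (rule sum_darts_eq_sum_edges[symmetric])
  also have "\<dots> = (\<Sum>x\<in>V. \<Sum>y\<in>N x. hit x y + hit y x)"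
  proof (intro sum.cong refl)
    fix x y assume "y \<in> N x"
    then have "x \<noteq> y" by auto
    then show "?c (Upair x y) = hit x y + hit y x" by simp
  qed
  also have "\<dots> = (\<Sum>x\<in>V. \<Sum>y\<in>N x. hit x y) + (\<Sum>x\<in>V. \<Sum>y\<in>N x. hit y x)"
    by (simp only: sum.distrib)
  also have "(\<Sum>x\<in>V. \<Sum>y\<in>N x. hit y x) = (\<Sum>x\<in>V. \<Sum>y\<in>N x. hit x y)"
    by (rule sum_darts_swap)
  also have "(\<Sum>x\<in>V. \<Sum>y\<in>N x. hit x y) = (\<Sum>x\<in>V. 2 * m - d x)"
  proof (intro sum.cong refl)
    fix x assume "x \<in> V"
    then show "(\<Sum>y\<in>N x. hit x y) = 2 * m - d x"
      using poisson_hit[of x] by (auto simp: poisson_def sum_negf)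
  qed
  finally show ?thesis by (simp add: sum_subtractf sum_d algebra_simps)
qed

section \<open>The stationary distribution and Kemeny's constant\<close>

lemma pmf_step: "x \<in> V \<Longrightarrow> pmf (step_pmf G x) y = (if y \<in> N x then 1 / d x else 0)"
  using neighbours_nonempty by (simp add: step_pmf_def indicator_def)

lemma stationary_iff:
  assumes supp: "set_pmf p \<subseteq> V"
  shows "bind_pmf p (step_pmf G) = p \<longleftrightarrow> (\<forall>y\<in>V. (\<Sum>x\<in>N y. pmf p x / d x) = pmf p y)"
proof -
  have *: "pmf (bind_pmf p (step_pmf G)) y = (\<Sum>x\<in>N y. pmf p x / d x)" for y
  proof -
    have "pmf (bind_pmf p (step_pmf G)) y = (\<Sum>x\<in>V. pmf p x * pmf (step_pmf G x) y)"
      using supp by (subst pmf_bind, subst integral_measure_pmf[of V]) auto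
    also have "\<dots> = (\<Sum>x\<in>V. if x \<in> N y then pmf p x / d x else 0)"
      by (intro sum.cong) (auto simp: pmf_step neighbours_sym[of y])
    also have "\<dots> = (\<Sum>x\<in>N y. pmf p x / d x)"
      using neighbours_in_verts(1) by (subst sum.inter_restrict[symmetric]) (auto intro!: sum.cong)
    finally show ?thesis .
  qed
  have "(\<Sum>x\<in>N y. pmf p x / d x) = pmf p y" if "y \<notin> V" for y
    using that supp neighbours_in_verts by (subst sum.neutral) (auto simp: pmf_eq_0_set_pmf)
  then show ?thesis
    by (auto simp: pmf_eq_iff *)
qed

text \<open>
  Uniqueness, which the definite description in \<open>stationary_pmf\<close> asks for, again comes from
  harmonic functions: for a stationary distribution \<open>q\<close> the ratio \<open>q x / d x\<close> is harmonic, because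
  the walk is reversible.
\<close>

lemma stationary_pmf_eq:
  "pmf (stationary_pmf G) x = (if x \<in> V then d x / (2 * m) else 0)"
  and set_stationary: "set_pmf (stationary_pmf G) \<subseteq> V"
proof -
  let ?f = "\<lambda>x. if x \<in> V then d x / (2 * m) else 0"
  define p where "p = embed_pmf ?f"
  have "(\<integral>\<^sup>+x. ennreal (?f x) \<partial>count_space UNIV) = (\<Sum>x\<in>V. ennreal (?f x))"
    by (rule nn_integral_count_space') auto
  also have "\<dots> = ennreal (\<Sum>x\<in>V. d x / (2 * m))"
    using m_pos by (subst sum_ennreal[symmetric]) auto
  also have "(\<Sum>x\<in>V. d x / (2 * m)) = 1"
    using sum_d m_pos nonempty by (simp flip: sum_divide_distrib)
  finally have p: "pmf p x = ?f x" for x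
    unfolding p_def by (intro pmf_embed_pmf) auto
  then have supp: "set_pmf p \<subseteq> V"
    by (auto simp: set_pmf_iff split: if_splits)
  have stat: "bind_pmf p (step_pmf G) = p"
  proof (subst stationary_iff[OF supp], intro ballI)
    fix y assume "y \<in> V"
    have "(\<Sum>x\<in>N y. pmf p x / d x) = (\<Sum>x\<in>N y. 1 / (2 * m))"
    proof (intro sum.cong refl)
      fix x assume "x \<in> N y"
      then have "x \<in> V" by (rule neighbours_in_verts)
      then show "pmf p x / d x = 1 / (2 * m)"
        using d_pos[of x] neighbours_nonempty[of x] by (simp add: p)
    qed
    with \<open>y \<in> V\<close> show "(\<Sum>x\<in>N y. pmf p x / d x) = pmf p y"
      by (simp add: p)
  qed
  have uniq: "q = p" if q: "set_pmf q \<subseteq> V" "bind_pmf q (step_pmf G) = q" for q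
  proof -
    have bal: "(\<Sum>x\<in>N y. pmf q x / d x) = pmf q y" if "y \<in> V" for y
      using q that by (simp add: stationary_iff)
    obtain x0 where x0: "x0 \<in> V" using connected by (auto simp: connected_graph_def)
    define c where "c = pmf q x0 / d x0"
    have c: "pmf q x = c * d x" if "x \<in> V" for x
    proof -
      have "pmf q x / d x = c"
        unfolding c_def
      proof (rule harmonic_constant[of "\<lambda>x. pmf q x / d x"])
        fix x assume "x \<in> V"
        then show "(\<Sum>y\<in>N x. pmf q x / d x - pmf q y / d y) = 0"
          using bal[of x] d_pos[of x] neighbours_nonempty[of x] by (simp add: sum_subtractf)
      qed fact+
      then show ?thesis using neighbours_nonempty[OF that] by (simp add: divide_eq_eq)
    qed
    have "1 = (\<Sum>x\<in>V. pmf q x)"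
      using sum_pmf_eq_1[OF finite_verts q(1)] by simp
    also have "\<dots> = c * (2 * m)"
      by (simp add: c sum_d flip: sum_distrib_left)
    finally have "c = 1 / (2 * m)" using m_pos nonempty by (simp add: eq_divide_eq)
    then have "pmf q x = pmf p x" for x
      using c[of x] q(1) by (auto simp: p pmf_eq_0_set_pmf)
    then show ?thesis by (rule pmf_eqI)
  qed
  have "stationary_pmf G = p"
    unfolding stationary_pmf_def using supp stat uniq by (intro the_equality) blast+
  with p supp show "pmf (stationary_pmf G) x = ?f x" "set_pmf (stationary_pmf G) \<subseteq> V"
    by simp_all
qed

lemma kemeny_eq_sum_hit:
  assumes "v \<in> V"
  shows "kemeny G v = (\<Sum>w\<in>V. d w * hit w v) / (2 * m)"
proof -
  have "(\<integral>\<^sup>+ w. expected_hitting_time G v w \<partial>measure_pmf (stationary_pmf G))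
      = (\<Sum>w\<in>V. expected_hitting_time G v w * ennreal (pmf (stationary_pmf G) w))"
    using set_stationary by (intro nn_integral_measure_pmf_support) (auto simp: set_pmf_iff)
  also have "\<dots> = (\<Sum>w\<in>V. ennreal (hit w v * (d w / (2 * m))))"
    using assms by (intro sum.cong)
      (simp_all add: expected_hitting_time_eq_hit stationary_pmf_eq ennreal_mult hit_nonneg
        del: times_divide_eq_right)
  also have "\<dots> = ennreal (\<Sum>w\<in>V. hit w v * (d w / (2 * m)))"
    using assms by (intro sum_ennreal) (auto simp: hit_nonneg)
  finally have "kemeny G v = (\<Sum>w\<in>V. hit w v * (d w / (2 * m)))"
    using assms by (simp add: kemeny_def sum_nonneg hit_nonneg)
  then show ?thesis
    by (simp add: sum_divide_distrib mult.commute)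
qed

text \<open>
  As a function of the starting vertex, Kemeny's constant is an average of solutions of Poisson
  equations whose right-hand sides cancel: \<open>\<Sum>w. d w * d x\<close> against \<open>d x * (2 * m)\<close>. So it is
  harmonic.
\<close>

lemma kemeny_start_independent:
  assumes "u \<in> V" "v \<in> V"
  shows "kemeny G u = kemeny G v"
proof -
  let ?k = "\<lambda>x. \<Sum>w\<in>V. d w * hit w x"
  have "?k u = ?k v"
  proof (rule harmonic_constant)
    fix x assume x: "x \<in> V"
    have "(\<Sum>y\<in>N x. ?k x - ?k y) = (\<Sum>w\<in>V. d w * (\<Sum>y\<in>N x. hit w x - hit w y))"
      by (simp add: sum_distrib_left sum.swap[of _ _ V] algebra_simps flip: sum_subtractf)
    also have "\<dots> = (\<Sum>w\<in>V. d w * (d x - (if x = w then 2 * m else 0)))"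
      using poisson_hit x by (intro sum.cong) (auto simp: poisson_def)
    also have "\<dots> = (\<Sum>w\<in>V. d w) * d x - (\<Sum>w\<in>V. if x = w then d w * (2 * m) else 0)"
      unfolding sum_distrib_right sum_subtractf[symmetric]
      by (intro sum.cong) (auto simp: algebra_simps)
    also have "\<dots> = 0"
      using x by (simp add: sum_d)
    finally show "(\<Sum>y\<in>N x. ?k x - ?k y) = 0" .
  qed fact+
  then show ?thesis using assms by (simp add: kemeny_eq_sum_hit)
qed

text \<open>
  This reduces the computation of Kemeny's constant to exhibiting a solution of the Poisson
  equation for every target. Only the difference to the value at the target enters, so solutions
  can be chosen up to a constant.
\<close>

lemma kemeny_eq_poisson:
  assumes "v \<in> V" "\<And>w. w \<in> V \<Longrightarrow> poisson w (\<lambda>x. f x w)"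
  shows "kemeny G v = (\<Sum>w\<in>V. d w * (f v w - f w w)) / (2 * m)"
proof -
  have "hit w v = f v w - f w w" if "w \<in> V" for w
    using poisson_unique[OF poisson_hit[OF that] assms(2)[OF that] assms(1) that] by simp
  then show ?thesis by (simp add: kemeny_eq_sum_hit[OF assms(1)])
qed

end

section \<open>The structure of the blow-up\<close>

lemma Upair_swap: "Upair x y = Upair y x" by simp

lemma Old_in_clique [simp]: "Old x \<in> cl_clique n e \<longleftrightarrow> x \<in> set_uprod e"
  by (auto simp: cl_clique_def)

lemma New_in_clique [simp]: "New e' i \<in> cl_clique n e \<longleftrightarrow> e' = e \<and> i < n - 2"
  by (auto simp: cl_clique_def)

lemma Upair_in_edges_CL:
  "Upair p q \<in> edges (CL n G) \<longleftrightarrow> p \<noteq> q \<and> (\<exists>e\<in>edges G. p \<in> cl_clique n e \<and> q \<in> cl_clique n e)"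
  unfolding CL_def by auto

lemma verts_CL:
  "verts (CL n G) = Old ` verts G \<union> (\<lambda>(e, i). New e i) ` (edges G \<times> {..<n - 2})"
  unfolding CL_def by auto

text \<open>
  Here \<open>k\<close> stands for \<open>n - 1\<close>, \<open>S\<close> for \<open>\<Sum>z. d z * hit z x\<close>, \<open>M\<close> and \<open>N\<close> for the numbers of edges
  and vertices. The factor \<open>1 + (n - 2) / 2 = n / 2\<close> of \<open>k\<^sup>2 * S\<close> cancels against the denominator.
\<close>

lemma kemeny_step_algebra:
  fixes n k S M N :: real
  assumes "k > 0" "n > 0" "M > 0"
  shows "(k\<^sup>2 * S + (n - 2) * (k\<^sup>2 / 2 * S - k\<^sup>2 / 4 * (2 * M * (N - 1)) + M * (k\<^sup>2 / 2 * (3 * M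
      - 1)))) / (n * k * M)
    = k * (S / (2 * M)) + k * (n - 2) / (2 * n) * (3 * M - N)"
proof -
  have "k\<^sup>2 * S + (n - 2) * (k\<^sup>2 / 2 * S - k\<^sup>2 / 4 * (2 * M * (N - 1)) + M * (k\<^sup>2 / 2 * (3 * M
      - 1)))
    = (n * k * M) * (k * (S / (2 * M)) + k * (n - 2) / (2 * n) * (3 * M - N))"
    using assms by (simp add: field_simps power2_eq_square)
  then show ?thesis using assms by simp
qed

locale blow_up = walk_graph G for G :: "'a cl_vertex ugraph" +
  fixes n :: nat
  assumes n_ge_3: "n \<ge> 3"
begin

abbreviation H :: "'a cl_vertex ugraph" where "H \<equiv> CL n G"

lemma real_n_minus_2: "real (n - 2) = real n - 2"
  using n_ge_3 by simp

lemma clique_subset_verts: "e \<in> edges G \<Longrightarrow> cl_clique n e \<subseteq> verts H"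
  using simple by (auto simp: verts_CL cl_clique_def finite_simple_graph_def)

lemma finite_simple_CL: "finite_simple_graph H"
  unfolding finite_simple_graph_def
proof (intro conjI ballI)
  show "finite (verts H)" by (simp add: verts_CL)
  fix e assume "e \<in> edges H"
  then obtain e0 p q where e: "e = Upair p q" "e0 \<in> edges G" "p \<in> cl_clique n e0" "q \<in> cl_clique
      n e0" "p \<noteq> q"
    by (auto simp: CL_def)
  then show "proper_uprod e" "set_uprod e \<subseteq> verts H"
    using clique_subset_verts[OF e(2)] by auto
qed

lemma Old_edge: "Upair x y \<in> edges G \<Longrightarrow> Upair (Old x) (Old y) \<in> edges H"
  using Upair_edgeD(3)[of x y] by (auto simp: Upair_in_edges_CL intro!: bexI[of _ "Upair x y"])

lemma connected_CL: "connected_graph H"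
proof -
  let ?R = "{(x, y). Upair x y \<in> edges G}" and ?S = "{(x, y). Upair x y \<in> edges H}"
  \<comment> \<open>Every vertex is joined to one fixed old vertex, and the relation is symmetric.\<close>
  have "sym ?S"
    unfolding sym_def using Upair_swap by (metis (no_types, lifting) case_prodD case_prodI
        mem_Collect_eq)
  then have sym: "sym (?S\<^sup>*)" by (rule sym_rtrancl)
  obtain x0 where x0: "x0 \<in> V" using connected by (auto simp: connected_graph_def)
  have Old: "(Old x0, Old x) \<in> ?S\<^sup>*" if "x \<in> V" for x
  proof -
    have "(x0, x) \<in> ?R\<^sup>*" using connected x0 that by (auto simp: connected_graph_def)
    then show ?thesis
    proof (induction rule: rtrancl_induct)
      case (step y z)
      then have "(Old y, Old z) \<in> ?S" using Old_edge by simp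
      with step.IH show ?case by (rule rtrancl_into_rtrancl)
    qed simp
  qed
  have all: "(Old x0, p) \<in> ?S\<^sup>*" if p: "p \<in> verts H" for p
  proof -
    from p consider x where "p = Old x" "x \<in> V" | e i where "p = New e i" "e \<in> edges G" "i < n - 2"
      by (auto simp: verts_CL)
    then show ?thesis
    proof cases
      case 1 then show ?thesis using Old by simp
    next
      case 2
      from 2(2) obtain x y where "e = Upair x y" "x \<in> V" by (rule edge_cases)
      moreover from this 2 have "(Old x, p) \<in> ?S" by (auto simp: Upair_in_edges_CL)
      ultimately show ?thesis using Old by (meson rtrancl_into_rtrancl)
    qed
  qed
  show ?thesis
    unfolding connected_graph_def
  proof (intro conjI ballI)
    show "verts H \<noteq> {}" using x0 by (auto simp: verts_CL)
    fix p q assume "p \<in> verts H" "q \<in> verts H"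
    then have "(p, Old x0) \<in> ?S\<^sup>*" "(Old x0, q) \<in> ?S\<^sup>*"
      using all sym by (auto dest: symD)
    then show "(p, q) \<in> ?S\<^sup>*" by (rule rtrancl_trans)
  qed
qed

lemma edges_CL_nonempty: "edges H \<noteq> {}"
proof -
  obtain e where "e \<in> edges G" using nonempty by blast
  then obtain x y where "e = Upair x y" by (cases e)
  with \<open>e \<in> edges G\<close> show ?thesis using Old_edge by blast
qed

sublocale CL: walk_graph H
  by unfold_locales (fact finite_simple_CL connected_CL edges_CL_nonempty)+

lemma neighbours_Old:
  "CL.N (Old x) = Old ` N x \<union> (\<lambda>(y, i). New (Upair x y) i) ` (N x \<times> {..<n - 2})" (is "_ = ?R")
proof (intro set_eqI iffI)
  fix q assume "q \<in> CL.N (Old x)"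
  then obtain e where q: "q \<noteq> Old x" "e \<in> edges G" "x \<in> set_uprod e" "q \<in> cl_clique n e"
    by (auto simp: neighbours_def Upair_in_edges_CL)
  obtain y where e: "e = Upair x y"
    using q(3) by (cases e) (auto simp: Upair_swap)
  then have "y \<in> N x" using q(2) by (simp add: neighbours_def)
  with q e show "q \<in> ?R" by (auto simp: cl_clique_def)
next
  fix q assume "q \<in> ?R"
  then obtain y where y: "y \<in> N x" "q \<in> insert (Old y) (New (Upair x y) ` {..<n - 2})" by auto
  then have "Upair x y \<in> edges G" by (simp add: neighbours_def)
  moreover have "q \<noteq> Old x" "q \<in> cl_clique n (Upair x y)" using y by (auto simp: cl_clique_def)
  ultimately show "q \<in> CL.N (Old x)"
    by (auto simp: neighbours_def Upair_in_edges_CL intro!: bexI[of _ "Upair x y"])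
qed

lemma sum_neighbours_Old:
  fixes F :: "'a cl_vertex \<Rightarrow> real"
  shows "(\<Sum>q\<in>CL.N (Old x). F q) = (\<Sum>y\<in>N x. F (Old y) + (\<Sum>i<n - 2. F (New (Upair x y) i)))"
proof -
  have inj: "inj_on (\<lambda>(y, i). New (Upair x y) i) (N x \<times> {..<n - 2})"
    by (auto simp: inj_on_def)
  have "(\<Sum>q\<in>CL.N (Old x). F q) = (\<Sum>q\<in>Old ` N x. F q)
      + (\<Sum>q\<in>(\<lambda>(y, i). New (Upair x y) i) ` (N x \<times> {..<n - 2}). F q)"
    unfolding neighbours_Old by (rule sum.union_disjoint) auto
  also have "(\<Sum>q\<in>Old ` N x. F q) = (\<Sum>y\<in>N x. F (Old y))"
    by (subst sum.reindex) (auto simp: inj_on_def)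
  also have "(\<Sum>q\<in>(\<lambda>(y, i). New (Upair x y) i) ` (N x \<times> {..<n - 2}). F q)
      = (\<Sum>y\<in>N x. \<Sum>i<n - 2. F (New (Upair x y) i))"
    by (subst sum.reindex[OF inj]) (simp add: sum.cartesian_product split_def)
  finally show ?thesis by (simp add: sum.distrib)
qed

lemma sum_neighbours_New:
  fixes F :: "'a cl_vertex \<Rightarrow> real"
  assumes "e \<in> edges G" "i < n - 2"
  shows "(\<Sum>q\<in>CL.N (New e i). F q)
    = (\<Sum>a\<in>set_uprod e. F (Old a)) + (\<Sum>j<n - 2. F (New e j)) - F (New e i)"
proof -
  have "CL.N (New e i) = cl_clique n e - {New e i}"
    using assms by (auto simp: neighbours_def Upair_in_edges_CL)
  moreover have "(\<Sum>q\<in>cl_clique n e. F q) = (\<Sum>q\<in>Old ` set_uprod e. F q) + (\<Sum>q\<in>New e ` {..<n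
      - 2}. F q)"
    unfolding cl_clique_def by (rule sum.union_disjoint) auto
  moreover have "\<dots> = (\<Sum>a\<in>set_uprod e. F (Old a)) + (\<Sum>j<n - 2. F (New e j))"
    by (simp add: sum.reindex inj_on_def)
  moreover have "finite (cl_clique n e)" by (simp add: cl_clique_def)
  ultimately show ?thesis using assms by (simp add: sum_diff1)
qed

lemma sum_verts_CL:
  fixes F :: "'a cl_vertex \<Rightarrow> real"
  shows "(\<Sum>q\<in>verts H. F q) = (\<Sum>x\<in>V. F (Old x)) + (\<Sum>e\<in>edges G. \<Sum>i<n - 2. F (New e i))"
proof -
  have inj: "inj_on (\<lambda>(e, i). New e i) (edges G \<times> {..<n - 2})"
    by (auto simp: inj_on_def)
  have "(\<Sum>q\<in>verts H. F q) = (\<Sum>q\<in>Old ` V. F q) + (\<Sum>q\<in>(\<lambda>(e, i). New e i) ` (edges G \<times> {..<n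
      - 2}). F q)"
    unfolding verts_CL by (rule sum.union_disjoint) auto
  also have "(\<Sum>q\<in>Old ` V. F q) = (\<Sum>x\<in>V. F (Old x))"
    by (subst sum.reindex) (auto simp: inj_on_def)
  also have "(\<Sum>q\<in>(\<lambda>(e, i). New e i) ` (edges G \<times> {..<n - 2}). F q)
      = (\<Sum>e\<in>edges G. \<Sum>i<n - 2. F (New e i))"
    by (subst sum.reindex[OF inj]) (simp add: sum.cartesian_product split_def)
  finally show ?thesis .
qed

lemma card_set_edge: "e \<in> edges G \<Longrightarrow> card (set_uprod e) = 2"
  by (erule edge_cases) simp

lemma degree_Old: "CL.d (Old x) = (real n - 1) * d x"
  using sum_neighbours_Old[of "\<lambda>_. 1" x] by (simp add: real_n_minus_2 algebra_simps)

lemma degree_New: "e \<in> edges G \<Longrightarrow> i < n - 2 \<Longrightarrow> CL.d (New e i) = real n - 1"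
  using sum_neighbours_New[of e i "\<lambda>_. 1"] by (simp add: real_n_minus_2 card_set_edge)

lemma card_verts_CL: "real (card (verts H)) = real (card V) + (real n - 2) * m"
  using sum_verts_CL[of "\<lambda>_. 1"] by (simp add: real_n_minus_2 algebra_simps)

text \<open>
  Counted through the degree sum, which avoids counting the edges inside each clique.
\<close>

lemma card_edges_CL: "2 * CL.m = real n * (real n - 1) * m"
proof -
  have "2 * CL.m = (real n - 1) * (\<Sum>x\<in>V. d x) + (\<Sum>e\<in>edges G. \<Sum>i<n - 2. real n - 1)"
    unfolding CL.sum_d[symmetric] sum_verts_CL by (simp add: degree_Old degree_New sum_distrib_left)
  then show ?thesis by (simp add: sum_d real_n_minus_2 algebra_simps)
qed

section \<open>Solving the Poisson equation on the blow-up\<close>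

text \<open>
  The solution for the target \<open>w\<close> at the old vertices. The target \<open>New e i\<close> is reached through the
  ends of \<open>e\<close>, which share its weight equally. Vertices of the form \<open>Base\<close> do not occur in a
  blow-up.
\<close>

definition old_potential :: "'a cl_vertex \<Rightarrow> 'a cl_vertex \<Rightarrow> real" where
  "old_potential w x = (case w of
      Old z \<Rightarrow> (real n - 1) * hit z x
    | New e i \<Rightarrow> (real n - 1) / 2 * (\<Sum>a\<in>set_uprod e. hit a x)
    | Base _ \<Rightarrow> 0)"

text \<open>
  Compared with what the ends of the edge would give, the mass removed at a new target lowers the
  value at every new vertex of its clique by \<open>(n - 1) * m / 2\<close>, and at the target itself by three
  times that. These constants solve the equations
  \<open>(n - 1) - n * c i + (\<Sum>j. c j) = (n - 1) - (if i = j then 2 * m' else 0)\<close> for the drops \<open>c\<close>,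
  where \<open>m' = n * (n - 1) / 2 * m\<close> is the number of edges of the blow-up.
\<close>

definition target_drop :: "'a cl_vertex \<Rightarrow> 'a cl_vertex uprod \<Rightarrow> nat \<Rightarrow> real" where
  "target_drop w e i = (case w of
      New e' j \<Rightarrow> if e' = e then (real n - 1) * m / 2 + (if j = i then (real n
          - 1) * m else 0) else 0
    | _ \<Rightarrow> 0)"

text \<open>
  At a new vertex the value is the mean of the values at the two ends plus \<open>(n - 1) / 2\<close>, up to
  the drop caused by the target. These values are forced by the equations at the new vertices of a
  clique once the old values are given.
\<close>

definition potential :: "'a cl_vertex \<Rightarrow> 'a cl_vertex \<Rightarrow> real" where
  "potential w q = (case q of
      Old x \<Rightarrow> old_potential w x
    | New e i \<Rightarrow> (\<Sum>a\<in>set_uprod e. old_potential w a) / 2 + (real n - 1) / 2 - target_drop w e i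
    | Base _ \<Rightarrow> 0)"

lemma sum_target_drop:
  assumes "w \<in> verts H"
  shows "(\<Sum>i<n - 2. target_drop w e i)
    = (if \<exists>j. w = New e j then real n * (real n - 1) * m / 2 else 0)"
proof (cases "\<exists>j. w = New e j")
  case True
  then obtain j where j: "w = New e j" by blast
  with assms have "j < n - 2" by (auto simp: verts_CL)
  with j show ?thesis
    by (simp add: target_drop_def sum.distrib real_n_minus_2) (simp add: field_simps)
next
  case False
  then have "target_drop w e i = 0" for i
    by (auto simp: target_drop_def split: cl_vertex.splits)
  with False show ?thesis by simp
qed

lemma poisson_at_New:
  assumes "w \<in> verts H" "e \<in> edges G" "i < n - 2"
  shows "(\<Sum>q\<in>CL.N (New e i). potential w (New e i) - potential w q)
    = CL.d (New e i) - (if New e i = w then 2 * CL.m else 0)"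
proof -
  let ?F = "potential w" and ?s = "\<Sum>a\<in>set_uprod e. old_potential w a"
  have "(\<Sum>q\<in>CL.N (New e i). ?F (New e i) - ?F q)
      = (real n - 1) * ?F (New e i) - (\<Sum>q\<in>CL.N (New e i). ?F q)"
    using degree_New[OF assms(2,3)] by (simp add: sum_subtractf)
  also have "\<dots> = real n * ?F (New e i) - ?s - (\<Sum>j<n - 2. ?F (New e j))"
  proof -
    have "(\<Sum>a\<in>set_uprod e. ?F (Old a)) = ?s" by (simp add: potential_def)
    then show ?thesis
      unfolding sum_neighbours_New[OF assms(2,3)] by (simp add: algebra_simps)
  qed
  also have "(\<Sum>j<n - 2. ?F (New e j)) = (real n - 2) * (?s / 2 + (real n - 1) / 2) - (\<Sum>j<n
      - 2. target_drop w e j)"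
    by (simp add: potential_def sum_subtractf real_n_minus_2)
  also have "real n * ?F (New e i) - ?s - \<dots> = real n - 1 - real n * target_drop w e i + (\<Sum>j<n
      - 2. target_drop w e j)"
  proof -
    have "real n * (s / 2 + (real n - 1) / 2 - t) - s - ((real n - 2) * (s / 2 + (real n
        - 1) / 2) - T)
        = real n - 1 - real n * t + T" for s t T
      by (simp add: field_simps)
    then show ?thesis by (simp only: potential_def cl_vertex.case)
  qed
  also have "\<dots> = (real n - 1) - (if New e i = w then real n * (real n - 1) * m else 0)"
    unfolding sum_target_drop[OF assms(1)]
    by (auto simp: target_drop_def field_simps split: cl_vertex.splits)
  finally show ?thesis
    using degree_New[OF assms(2,3)] by (simp add: card_edges_CL)
qed

text \<open>
  Among the cliques at \<open>x\<close> at most one contains a given new target.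
\<close>

lemma sum_drops_at_Old:
  assumes "w \<in> verts H" "x \<in> V"
  shows "(\<Sum>y\<in>N x. \<Sum>i<n - 2. target_drop w (Upair x y) i)
    = (if \<exists>e i. w = New e i \<and> x \<in> set_uprod e then real n * (real n - 1) * m / 2 else 0)"
proof (cases "\<exists>e i. w = New e i \<and> x \<in> set_uprod e")
  case True
  then obtain e i where w: "w = New e i" "x \<in> set_uprod e" by blast
  then obtain z where z: "e = Upair x z"
    by (cases e) (auto simp: Upair_swap)
  have "e \<in> edges G" using assms(1) w by (auto simp: verts_CL)
  then have "z \<in> N x" using z by (simp add: neighbours_def)
  have "(\<Sum>y\<in>N x. \<Sum>i<n - 2. target_drop w (Upair x y) i)
     = (\<Sum>y\<in>N x. if y = z then real n * (real n - 1) * m / 2 else 0)"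
    unfolding sum_target_drop[OF assms(1)] using w z by (intro sum.cong) auto
  with True \<open>z \<in> N x\<close> show ?thesis by simp
next
  case False
  have "(\<Sum>y\<in>N x. \<Sum>i<n - 2. target_drop w (Upair x y) i) = (\<Sum>y\<in>N x. 0)"
    unfolding sum_target_drop[OF assms(1)] using False by (intro sum.cong) auto
  then show ?thesis unfolding if_not_P[OF False] by simp
qed

text \<open>
  For an old target the Laplacian of \<open>G\<close> produces a single point mass; for a new target the two
  ends of its edge carry half of it each.
\<close>

lemma laplacian_old_potential:
  assumes "w \<in> verts H" "x \<in> V"
  shows "(\<Sum>y\<in>N x. old_potential w x - old_potential w y)
    = (real n - 1) * d x - (if w = Old x then 2 * (real n - 1) * m
        else if \<exists>e i. w = New e i \<and> x \<in> set_uprod e then (real n - 1) * m else 0)"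
proof -
  have hit: "(\<Sum>y\<in>N x. hit z x - hit z y) = d x - (if x = z then 2 * m else 0)" if "z \<in> V" for z
    using poisson_hit[OF that] assms(2) by (simp add: poisson_def)
  from assms(1) consider z where "w = Old z" "z \<in> V" | e i where "w = New e i" "e \<in> edges G"
    by (auto simp: verts_CL)
  then show ?thesis
  proof cases
    case 1
    then have "(\<Sum>y\<in>N x. old_potential w x - old_potential w y) = (real n - 1) * (\<Sum>y\<in>N x. hit z x
        - hit z y)"
      by (simp add: old_potential_def sum_distrib_left algebra_simps)
    also have "\<dots> = (real n - 1) * (d x - (if x = z then 2 * m else 0))"
      by (simp only: hit[OF 1(2)])
    finally have L: "(\<Sum>y\<in>N x. old_potential w x - old_potential w y) = \<dots>" .
    show ?thesis unfolding L using 1 by (auto simp: algebra_simps)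
  next
    case 2
    from 2(2) obtain a b where ab: "e = Upair a b" "a \<in> V" "b \<in> V" "a \<noteq> b" by (rule edge_cases)
    with 2 have "(\<Sum>y\<in>N x. old_potential w x - old_potential w y)
        = (real n - 1) / 2 * ((\<Sum>y\<in>N x. hit a x - hit a y) + (\<Sum>y\<in>N x. hit b x - hit b y))"
      by (simp add: old_potential_def sum_distrib_left algebra_simps flip: sum.distrib)
    also have "\<dots> = (real n - 1) / 2 * (d x - (if x = a then 2 * m else 0) + (d x - (if x
        = b then 2 * m else 0)))"
      by (simp only: hit[OF ab(2)] hit[OF ab(3)])
    finally have L: "(\<Sum>y\<in>N x. old_potential w x - old_potential w y) = \<dots>" .
    show ?thesis unfolding L using 2 ab by (auto simp: field_simps)
  qed
qed

text \<open>
  Each neighbour \<open>y\<close> in \<open>G\<close> contributes a whole clique. As the value at a new vertex is a mean,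
  each of the \<open>n - 2\<close> new vertices contributes half the difference between \<open>x\<close> and \<open>y\<close>, so
  together with \<open>y\<close> itself they give the factor \<open>1 + (n - 2) / 2 = n / 2\<close>. For a new target the
  point mass \<open>(n - 1) * m\<close> at \<open>x\<close>, multiplied by \<open>n / 2\<close>, is cancelled by the drops in the clique
  that contains it.
\<close>

lemma poisson_at_Old:
  assumes "w \<in> verts H" "x \<in> V"
  shows "(\<Sum>q\<in>CL.N (Old x). potential w (Old x) - potential w q)
    = CL.d (Old x) - (if Old x = w then 2 * CL.m else 0)"
proof -
  let ?P = "old_potential w"
  have "(\<Sum>q\<in>CL.N (Old x). potential w (Old x) - potential w q)
    = (\<Sum>y\<in>N x. ?P x - ?P y + (\<Sum>i<n - 2. ?P x - ((?P x + ?P y) / 2 + (real n - 1) / 2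
        - target_drop w (Upair x y) i)))"
    unfolding sum_neighbours_Old
  proof (intro sum.cong refl)
    fix y assume "y \<in> N x"
    then have "x \<noteq> y" by auto
    then show "potential w (Old x) - potential w (Old y) + (\<Sum>i<n - 2. potential w (Old x)
        - potential w (New (Upair x y) i))
       = ?P x - ?P y + (\<Sum>i<n - 2. ?P x - ((?P x + ?P y) / 2 + (real n - 1) / 2
           - target_drop w (Upair x y) i))"
      by (simp add: potential_def)
  qed
  also have "\<dots> = (\<Sum>y\<in>N x. real n / 2 * (?P x - ?P y) - (real n - 1) * (real n - 2) / 2
      + (\<Sum>i<n - 2. target_drop w (Upair x y) i))"
  proof (intro sum.cong refl)
    fix y
    have "(\<Sum>i<n - 2. a - (b - t i)) = (real n - 2) * (a - b) + (\<Sum>i<n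
        - 2. t i)" for a b and t :: "nat \<Rightarrow> real"
      by (simp add: sum.distrib sum_subtractf real_n_minus_2 algebra_simps)
    note this[of "?P x" _ "target_drop w (Upair x y)"]
    then show "?P x - ?P y + (\<Sum>i<n - 2. ?P x - ((?P x + ?P y) / 2 + (real n - 1) / 2
        - target_drop w (Upair x y) i))
      = real n / 2 * (?P x - ?P y) - (real n - 1) * (real n - 2) / 2 + (\<Sum>i<n
          - 2. target_drop w (Upair x y) i)"
      by (simp only:) (simp add: field_simps)
  qed
  also have "\<dots> = real n / 2 * (\<Sum>y\<in>N x. ?P x - ?P y) - (real n - 1) * (real n - 2) / 2 * d x
      + (\<Sum>y\<in>N x. \<Sum>i<n - 2. target_drop w (Upair x y) i)"
    unfolding sum.distrib sum_subtractf sum_distrib_left[symmetric] by (simp add: algebra_simps)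
  also have "\<dots> = (real n - 1) * d x - (if Old x = w then real n * (real n - 1) * m else 0)"
    unfolding laplacian_old_potential[OF assms] sum_drops_at_Old[OF assms]
    by (auto simp: field_simps)
  finally show ?thesis
    by (simp add: degree_Old card_edges_CL)
qed

lemma poisson_potential:
  assumes "w \<in> verts H"
  shows "CL.poisson w (potential w)"
  unfolding CL.poisson_def
proof
  fix q assume "q \<in> verts H"
  then consider x where "q = Old x" "x \<in> V" | e i where "q = New e i" "e \<in> edges G" "i < n - 2"
    by (auto simp: verts_CL)
  then show "(\<Sum>y\<in>CL.N q. potential w q - potential w y) = CL.d q - (if q = w then 2 * CL.m else 0)"
    using poisson_at_Old[OF assms] poisson_at_New[OF assms] by cases simp_all
qed

text \<open>
  For a new target in the clique of an edge the potential at \<open>x\<close> is \<open>(n - 1) / 2\<close> times the sum of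
  the hitting times to the ends, and at the target it is \<open>(n - 1) / 4\<close> times the commute time
  between the ends, up to a constant. Summed over the edges, the former gives \<open>\<Sum>z. d z * hit z x\<close>,
  that is, \<open>2 * m\<close> times the constant of \<open>G\<close>, and the latter is Foster's sum.
\<close>

lemma kemeny_CL:
  assumes "x \<in> V" "p \<in> verts H"
  shows "kemeny H p = (real n - 1) * kemeny G x
    + (real n - 1) * (real n - 2) / (2 * real n) * (3 * m - real (card V))"
proof -
  define k where "k = real n - 1"
  define S where "S = (\<Sum>z\<in>V. d z * hit z x)"
  let ?t = "\<lambda>w. CL.d w * (potential w (Old x) - potential w w)"
  have x: "Old x \<in> verts H" using assms by (simp add: verts_CL)
  have k: "kemeny G x = S / (2 * m)"
    using kemeny_eq_sum_hit[OF assms(1)] by (simp add: S_def)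
  \<comment> \<open>Since \<open>Old x\<close> is the starting vertex, \<open>?t w\<close> is the contribution of the target \<open>w\<close>.\<close>
  have old: "(\<Sum>z\<in>V. ?t (Old z)) = k\<^sup>2 * S"
    by (simp add: S_def degree_Old potential_def old_potential_def sum_distrib_left k_def
        power2_eq_square algebra_simps)
  have new: "?t (New e i) = k\<^sup>2 / 2 * (\<Sum>a\<in>set_uprod e. hit a x)
      - k\<^sup>2 / 4 * (\<Sum>a\<in>set_uprod e. \<Sum>b\<in>set_uprod e. hit b a) + k\<^sup>2 / 2 * (3 * m - 1)"
    if "e \<in> edges G" "i < n - 2" for e i
  proof -
    have P: "(\<Sum>a\<in>set_uprod e. old_potential (New e i) a)
        = k / 2 * (\<Sum>a\<in>set_uprod e. \<Sum>b\<in>set_uprod e. hit b a)"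
      by (simp add: old_potential_def k_def sum_distrib_left)
    have Q: "potential (New e i) (New e i) = k / 4 * (\<Sum>a\<in>set_uprod e. \<Sum>b\<in>set_uprod e. hit b a) +
        k / 2 - 3 / 2 * k * m"
      by (simp add: potential_def P target_drop_def k_def[symmetric])
    have R: "potential (New e i) (Old x) = k / 2 * (\<Sum>a\<in>set_uprod e. hit a x)"
      by (simp add: potential_def old_potential_def k_def)
    have "k * (k / 2 * s - (k / 4 * t + k / 2 - 3 / 2 * k * M)) = k\<^sup>2 / 2 * s
        - k\<^sup>2 / 4 * t + k\<^sup>2 / 2 * (3 * M - 1)" for s t M
      by (simp add: field_simps power2_eq_square)
    then show ?thesis
      unfolding Q R degree_New[OF that] k_def[symmetric] .
  qed
  have "(\<Sum>e\<in>edges G. \<Sum>i<n - 2. ?t (New e i))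
     = (real n - 2) * (\<Sum>e\<in>edges G. k\<^sup>2 / 2 * (\<Sum>a\<in>set_uprod e. hit a x)
      - k\<^sup>2 / 4 * (\<Sum>a\<in>set_uprod e. \<Sum>b\<in>set_uprod e. hit b a) + k\<^sup>2 / 2 * (3 * m - 1))"
    by (simp add: new real_n_minus_2 sum_distrib_left)
  also have "\<dots> = (real n - 2) * (k\<^sup>2 / 2 * S - k\<^sup>2 / 4 * (2 * m * (real (card V)
      - 1)) + m * (k\<^sup>2 / 2 * (3 * m - 1)))"
    unfolding sum.distrib sum_subtractf sum_distrib_left[symmetric] sum_edges_endpoints
        sum_commute_times
    by (simp add: S_def algebra_simps)
  finally have sum: "(\<Sum>w\<in>verts H. ?t w) = k\<^sup>2 * S
      + (real n - 2) * (k\<^sup>2 / 2 * S - k\<^sup>2 / 4 * (2 * m * (real (card V)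
          - 1)) + m * (k\<^sup>2 / 2 * (3 * m - 1)))"
    by (simp only: sum_verts_CL old)
  have "kemeny H p = kemeny H (Old x)"
    using CL.kemeny_start_independent[OF assms(2) x] .
  also have "\<dots> = (\<Sum>w\<in>verts H. ?t w) / (2 * CL.m)"
    by (rule CL.kemeny_eq_poisson[where f = "\<lambda>x w. potential w x"]) (use x poisson_potential in
        auto)
  also have "\<dots> = k * (S / (2 * m)) + k * (real n - 2) / (2 * real n) * (3 * m - real (card V))"
    unfolding sum card_edges_CL k_def[symmetric]
    by (rule kemeny_step_algebra) (use n_ge_3 m_pos in \<open>simp_all add: k_def\<close>)
  finally show ?thesis by (simp add: k k_def)
qed

end

section \<open>Relabelling the initial graph\<close>

definition base_graph :: "'a ugraph \<Rightarrow> 'a cl_vertex ugraph" where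
  "base_graph G = \<lparr>verts = Base ` verts G, edges = map_uprod Base ` edges G\<rparr>"

context walk_graph
begin

lemma Upair_in_edges_base:
  "Upair p q \<in> edges (base_graph G) \<longleftrightarrow> (\<exists>x y. p = Base x \<and> q
      = Base y \<and> Upair x y \<in> edges G)" (is "_ \<longleftrightarrow> ?R")
proof
  assume "Upair p q \<in> edges (base_graph G)"
  then obtain e where e: "Upair p q = map_uprod Base e" "e \<in> edges G" by (auto simp: base_graph_def)
  then obtain x y where xy: "e = Upair x y" by (cases e)
  with e(2) have "Upair y x \<in> edges G" using Upair_swap[of x y] by simp
  with e xy show ?R by auto
next
  assume ?R
  then obtain x y where xy: "p = Base x" "q = Base y" "Upair x y \<in> edges G" by blast
  then have "Upair p q = map_uprod Base (Upair x y)" by simp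
  then have "Upair p q \<in> map_uprod Base ` edges G" using xy(3) by (rule image_eqI)
  then show "Upair p q \<in> edges (base_graph G)" by (simp only: base_graph_def ugraph.select_convs)
qed

lemma neighbours_base: "neighbours (base_graph G) (Base x) = Base ` N x"
  by (auto simp: neighbours_def Upair_in_edges_base)

lemma walk_graph_base: "walk_graph (base_graph G)"
proof
  show "finite_simple_graph (base_graph G)"
    unfolding finite_simple_graph_def
  proof (intro conjI ballI)
    show "finite (verts (base_graph G))" by (simp add: base_graph_def)
    fix e assume "e \<in> edges (base_graph G)"
    then obtain e0 where e0: "e0 \<in> edges G" "e = map_uprod Base e0" by (auto simp: base_graph_def)
    from e0(1) obtain x y where "e0 = Upair x y" "x \<in> V" "y \<in> V" "x \<noteq> y" by (rule edge_cases)
    with e0 show "proper_uprod e" "set_uprod e \<subseteq> verts (base_graph G)"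
      by (auto simp: base_graph_def)
  qed
  let ?S = "{(x, y). Upair x y \<in> edges (base_graph G)}"
  have "(Base u, Base v) \<in> ?S\<^sup>*" if "u \<in> V" "v \<in> V" for u v
  proof -
    have "(u, v) \<in> {(x, y). Upair x y \<in> edges G}\<^sup>*"
      using connected that by (auto simp: connected_graph_def)
    then show ?thesis
    proof (induction rule: rtrancl_induct)
      case (step y z)
      then have "(Base y, Base z) \<in> ?S" by (auto simp: Upair_in_edges_base)
      with step.IH show ?case by (rule rtrancl_into_rtrancl)
    qed simp
  qed
  then show "connected_graph (base_graph G)"
    using connected by (auto simp: connected_graph_def base_graph_def)
  show "edges (base_graph G) \<noteq> {}" using nonempty by (simp add: base_graph_def)
qed

lemma card_verts_base: "card (verts (base_graph G)) = card V"
  by (simp add: base_graph_def card_image inj_on_def)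

lemma card_edges_base: "card (edges (base_graph G)) = card (edges G)"
proof -
  have "inj (map_uprod (Base :: 'v \<Rightarrow> 'v cl_vertex))"
  proof (rule injI)
    fix e e' :: "'v uprod"
    assume "map_uprod (Base :: 'v \<Rightarrow> 'v cl_vertex) e = map_uprod Base e'"
    then show "e = e'" by (cases e, cases e') auto
  qed
  then show ?thesis
    unfolding base_graph_def using card_image inj_on_subset by (metis select_convs(2) subset_UNIV)
qed

text \<open>
  The hitting times of \<open>G\<close>, read through the relabelling, solve the Poisson equation of the
  relabelled graph; so invariance under this isomorphism does not require transporting the
  trajectory space.
\<close>

lemma kemeny_base:
  assumes "u \<in> V"
  shows "kemeny (base_graph G) (Base u) = kemeny G u"
proof -
  interpret base: walk_graph "base_graph G" by (rule walk_graph_base)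
  define lab :: "'v cl_vertex \<Rightarrow> 'v" where "lab p = (case p of Base x \<Rightarrow> x)" for p
  have [simp]: "lab (Base x) = x" for x by (simp add: lab_def)
  have V: "verts (base_graph G) = Base ` V" by (simp add: base_graph_def)
  have "kemeny (base_graph G) (Base u)
    = (\<Sum>w\<in>verts (base_graph G). base.d w * (hit (lab w) (lab (Base u))
        - hit (lab w) (lab w))) / (2 * base.m)"
  proof (rule base.kemeny_eq_poisson[where f = "\<lambda>p w. hit (lab w) (lab p)"])
    show "Base u \<in> verts (base_graph G)" using assms by (simp add: V)
    fix w assume "w \<in> verts (base_graph G)"
    then obtain z where z: "w = Base z" "z \<in> V" by (auto simp: V)
    show "base.poisson w (\<lambda>p. hit (lab w) (lab p))"
      using poisson_hit[OF z(2)] z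
      by (auto simp: base.poisson_def poisson_def V card_edges_base neighbours_base sum.reindex
          card_image inj_on_def)
  qed
  also have "\<dots> = kemeny G u"
    using assms by (simp add: V card_edges_base neighbours_base sum.reindex card_image inj_on_def
        kemeny_eq_sum_hit)
  finally show ?thesis .
qed

end

section \<open>Iterating the recursion\<close>

text \<open>
  Here \<open>Q\<close> stands for the power \<open>(n * (n - 1) / 2) ^ r\<close> by which the number of edges has grown;
  the identity rests on \<open>n * (n - 1) / 2 - 1 = (n - 2) * (n + 1) / 2\<close>.
\<close>

lemma vertex_count_algebra:
  fixes n Q V E :: real
  assumes "n \<ge> 3"
  shows "V + 2 * (Q - 1) / (n + 1) * E + (n - 2) * (Q * E) = V + 2 * (n * (n - 1) / 2 * Q
      - 1) / (n + 1) * E"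
proof -
  have coeff: "2 * (Q - 1) / (n + 1) + (n - 2) * Q = 2 * (n * (n - 1) / 2 * Q - 1) / (n + 1)"
    using assms by (simp add: field_simps)
  show ?thesis unfolding coeff[symmetric] by (simp only: algebra_simps)
qed

text \<open>
  The induction step of \<open>iterated_recursion\<close>, with \<open>A\<close> for \<open>(n - 1) ^ r\<close> and \<open>B\<close> for
  \<open>(n / 2) ^ r\<close>, so that \<open>A * B\<close> is the growth factor of the edges. The coefficients of \<open>V\<close> and
  \<open>E\<close> are compared separately.
\<close>

lemma recursion_step_algebra:
  fixes n A B K V E :: real
  assumes "n \<ge> 3"
  shows "(n - 1) * (A * K + (n - 1) * (1 - A) / (2 * n) * V
      + (3 * A / n * (B - 1) + ((n + 1) * A - 2 * A * B - (n - 1)) / (n * (n + 1))) * E)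
    + (n - 1) * (n - 2) / (2 * n) * (3 * (A * B * E) - (V + 2 * (A * B - 1) / (n + 1) * E))
    = (n - 1) * A * K + (n - 1) * (1 - (n - 1) * A) / (2 * n) * V
      + (3 * ((n - 1) * A) / n * (n / 2 * B - 1)
       + ((n + 1) * ((n - 1) * A) - 2 * ((n - 1) * A) * (n / 2 * B) - (n - 1)) / (n * (n + 1))) * E"
proof -
  have v: "(n - 1) * ((n - 1) * (1 - A) / (2 * n)) - (n - 1) * (n - 2) / (2 * n) = (n - 1) * (1
      - (n - 1) * A) / (2 * n)"
    using assms by (simp add: field_simps)
  have e: "(n - 1) * (3 * A / n * (B - 1) + ((n + 1) * A - 2 * A * B - (n - 1)) / (n * (n + 1)))
      + (n - 1) * (n - 2) / (2 * n) * (3 * (A * B) - 2 * (A * B - 1) / (n + 1))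
     = 3 * ((n - 1) * A) / n * (n / 2 * B - 1)
       + ((n + 1) * ((n - 1) * A) - 2 * ((n - 1) * A) * (n / 2 * B) - (n - 1)) / (n * (n + 1))"
  proof -
    have "n \<noteq> 0" "n + 1 \<noteq> 0" using assms by auto
    then show ?thesis
      by (simp add: divide_simps) (simp add: algebra_simps)
  qed
  show ?thesis unfolding v[symmetric] e[symmetric] by (simp only: algebra_simps)
qed

text \<open>
  The left-hand side is the form suited to induction on \<open>r\<close>; the other one splits its last
  quotient by means of \<open>(n - 1) ^ r = (n - 1) * (n - 1) ^ (r - 1)\<close> and
  \<open>(n / 2) ^ r = n / 2 * (n / 2) ^ (r - 1)\<close>.
\<close>

lemma closed_form_algebra:
  fixes n A B K V E :: real
  assumes n: "n \<ge> 3" and "r \<ge> 1"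
  shows "(n - 1) * (1 - (n - 1) ^ r) / (2 * n) * V
    + (3 * (n - 1) ^ r / n * ((n / 2) ^ r - 1)
       + ((n + 1) * (n - 1) ^ r - 2 * (n - 1) ^ r * (n / 2) ^ r - (n - 1)) / (n * (n + 1))) * E
   = (n - 1) ^ (r + 1) / (2 * n) * (1 / (n - 1) ^ r - 1) * V
    + (3 * (n - 1) ^ r / n * (n ^ r / 2 ^ r - 1)
       + (n - 1) ^ r / (n + 1) * (1 - n ^ (r - 1) / 2 ^ (r - 1))
       + (n - 1) ^ r / (n * (n + 1)) * (1 - 1 / (n - 1) ^ (r - 1))) * E"
proof -
  obtain s where s: "r = Suc s" using assms by (cases r) auto
  define A where "A = (n - 1) ^ s"
  define B where "B = (n / 2) ^ s"
  have A: "A > 0" using n by (simp add: A_def)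
  have r: "(n - 1) ^ r = (n - 1) * A" "(n / 2) ^ r = n / 2 * B" "n ^ (r - 1) / 2 ^ (r - 1)
      = B" "n ^ r / 2 ^ r = n / 2 * B"
    "(n - 1) ^ (r + 1) = (n - 1) * ((n - 1) * A)" "(n - 1) ^ (r - 1) = A"
    by (simp_all add: A_def B_def s power_divide)
  have nz: "n \<noteq> 0" "n - 1 \<noteq> 0" "n + 1 \<noteq> 0" "A \<noteq> 0" using n A by auto
  have v: "(n - 1) * (1 - (n - 1) * A) / (2 * n) = (n - 1) * ((n - 1) * A) / (2 * n) * (1 / ((n
      - 1) * A) - 1)"
    using nz by (simp add: divide_simps)
  have e: "((n + 1) * ((n - 1) * A) - 2 * ((n - 1) * A) * (n / 2 * B) - (n - 1)) / (n * (n + 1))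
     = (n - 1) * A / (n + 1) * (1 - B) + (n - 1) * A / (n * (n + 1)) * (1 - 1 / A)"
    using nz by (simp add: divide_simps) (simp add: algebra_simps)
  show ?thesis unfolding r v e by (simp add: add.assoc)
qed

text \<open>
  The number of edges grows by the factor \<open>(n - 1) * (n / 2)\<close> and \<open>K\<close> by the factor \<open>n - 1\<close>, so
  after division by \<open>(n - 1) ^ r\<close> the inhomogeneous terms form geometric series in \<open>n / 2\<close> and in
  \<open>1 / (n - 1)\<close>.
\<close>

lemma iterated_recursion:
  fixes n :: real and K V E :: "nat \<Rightarrow> real"
  assumes n: "n \<ge> 3"
    and K: "\<And>r. K (Suc r) = (n - 1) * K r + (n - 1) * (n - 2) / (2 * n) * (3 * E r - V r)"
    and V: "\<And>r. V (Suc r) = V r + (n - 2) * E r"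
    and E: "\<And>r. E (Suc r) = n * (n - 1) / 2 * E r"
  shows "K r = (n - 1) ^ r * K 0 + (n - 1) * (1 - (n - 1) ^ r) / (2 * n) * V 0
    + (3 * (n - 1) ^ r / n * ((n / 2) ^ r - 1)
       + ((n + 1) * (n - 1) ^ r - 2 * (n - 1) ^ r * (n / 2) ^ r - (n - 1)) / (n * (n + 1))) * E 0"
proof -
  define q where "q = n * (n - 1) / 2"
  have E': "E r = q ^ r * E 0" for r
    by (induction r) (simp_all add: E q_def)
  have V': "V r = V 0 + 2 * (q ^ r - 1) / (n + 1) * E 0" for r
  proof (induction r)
    case (Suc r)
    show ?case
      unfolding V Suc E'[of r] power_Suc using vertex_count_algebra[OF n] by (simp only: q_def)
  qed simp
  have q: "q ^ r = (n - 1) ^ r * (n / 2) ^ r" for r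
    by (simp add: q_def flip: power_mult_distrib) (simp add: mult.commute)
  show ?thesis
  proof (induction r)
    case 0
    then show ?case using n by simp
  next
    case (Suc r)
    show ?case
      unfolding K Suc V'[of r] E'[of r] q[of r] power_Suc by (rule recursion_step_algebra[OF n])
  qed
qed

lemma CL_iter_0: "CL_iter n 0 G = base_graph G"
  and CL_iter_Suc: "CL_iter n (Suc r) G = CL n (CL_iter n r G)"
  by (simp_all add: CL_iter_def base_graph_def)

lemma walk_graph_CL_iter:
  assumes "walk_graph G" "n \<ge> 3"
  shows "walk_graph (CL_iter n r G)"
proof (induction r)
  case 0
  then show ?case using walk_graph.walk_graph_base[OF assms(1)] by (simp only: CL_iter_0)
next
  case (Suc r)
  then interpret walk_graph "CL_iter n r G" .
  interpret blow_up "CL_iter n r G" n by unfold_locales (rule assms(2))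
  show ?case unfolding CL_iter_Suc by (rule CL.walk_graph_axioms)
qed

theorem theorem4p3:
  fixes G :: "'a ugraph" and n r :: nat and u :: 'a and v :: "'a cl_vertex"
  assumes "n \<ge> 3" and "r \<ge> 1"
    and "finite_simple_graph G" and "connected_graph G" and "card (edges G) \<ge> 1"
    and "u \<in> verts G" and "v \<in> verts (CL_iter n r G)"
  shows "kemeny (CL_iter n r G) v =
      (real n - 1) ^ r * kemeny G u
    + (real n - 1) ^ (r + 1) / (2 * real n) * (1 / (real n - 1) ^ r - 1) * real (card (verts G))
    + (3 * (real n - 1) ^ r / real n * (real n ^ r / 2 ^ r - 1)
       + (real n - 1) ^ r / (real n + 1) * (1 - real n ^ (r - 1) / 2 ^ (r - 1))
       + (real n - 1) ^ r / (real n * (real n + 1)) * (1 - 1 / (real n - 1) ^ (r - 1)))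
      * real (card (edges G))"
proof -
  have card_pos: "edges G \<noteq> {}" using assms(5) by auto
  interpret walk_graph G by unfold_locales (fact assms card_pos)+
  let ?G = "\<lambda>r. CL_iter n r G"
  have wg: "walk_graph (?G r)" for r
    by (rule walk_graph_CL_iter[OF walk_graph_axioms assms(1)])
  have bu: "blow_up (?G r) n" for r
    using wg assms(1) by (simp add: blow_up_def blow_up_axioms_def)
  \<comment> \<open>By independence of the starting vertex any choice works; the one at \<open>0\<close> makes \<open>kemeny_base\<close>
    applicable.\<close>
  define start where "start r = (if r = 0 then Base u else SOME w. w \<in> verts (?G r))" for r
  have start: "start r \<in> verts (?G r)" for r
  proof -
    have "verts (?G r) \<noteq> {}"
      using walk_graph.connected[OF wg] by (simp add: connected_graph_def)
    then have "(SOME w. w \<in> verts (?G r)) \<in> verts (?G r)" by (rule some_in_eq[THEN iffD2])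
    moreover have "Base u \<in> verts (?G 0)" using assms(6) by (simp add: CL_iter_0 base_graph_def)
    ultimately show ?thesis by (simp add: start_def)
  qed
  define K where "K r = kemeny (?G r) (start r)" for r
  define V' where "V' r = real (card (verts (?G r)))" for r
  define E where "E r = real (card (edges (?G r)))" for r
  have "K (Suc r) = (real n - 1) * K r + (real n - 1) * (real n - 2) / (2 * real n) * (3 * E r
      - V' r)" for r
    using blow_up.kemeny_CL[OF bu start, of "start (Suc r)"] start[of "Suc r"]
    by (simp only: K_def V'_def E_def CL_iter_Suc)
  moreover have "V' (Suc r) = V' r + (real n - 2) * E r" for r
    using blow_up.card_verts_CL[OF bu] by (simp only: V'_def E_def CL_iter_Suc)
  moreover have "E (Suc r) = real n * (real n - 1) / 2 * E r" for r
    using blow_up.card_edges_CL[OF bu, of r] by (simp add: E_def CL_iter_Suc)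
  ultimately have closed: "K r = (real n - 1) ^ r * K 0
    + (real n - 1) * (1 - (real n - 1) ^ r) / (2 * real n) * V' 0
    + (3 * (real n - 1) ^ r / real n * ((real n / 2) ^ r - 1)
       + ((real n + 1) * (real n - 1) ^ r - 2 * (real n - 1) ^ r * (real n / 2) ^ r - (real n - 1))
         / (real n * (real n + 1))) * E 0"
    using assms(1) by (intro iterated_recursion) auto
  have K0: "K 0 = kemeny G u" "V' 0 = real (card (verts G))" "E 0 = real (card (edges G))"
    using kemeny_base[OF assms(6)]
    by (simp_all add: K_def V'_def E_def start_def CL_iter_0 card_verts_base card_edges_base)
  have "kemeny (?G r) v = K r"
    unfolding K_def using walk_graph.kemeny_start_independent[OF wg assms(7) start] .
  also have "\<dots> = (real n - 1) ^ r * kemeny G u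
    + ((real n - 1) * (1 - (real n - 1) ^ r) / (2 * real n) * real (card (verts G))
    + (3 * (real n - 1) ^ r / real n * ((real n / 2) ^ r - 1)
       + ((real n + 1) * (real n - 1) ^ r - 2 * (real n - 1) ^ r * (real n / 2) ^ r - (real n - 1))
         / (real n * (real n + 1))) * real (card (edges G)))"
    unfolding closed K0 by (simp only: add.assoc)
  finally show ?thesis
    using closed_form_algebra[of "real n" r] assms(1,2) by (simp only: add.assoc)
qed

end
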